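(* Let $G = T\cup C$ be a cubic (i.e. $3$-regular) Halin graph with characteristic tree $T$ and adjoint cycle $C$. Then $\chi'_s(G)\leq 6$.
   Context: All graphs are finite and simple. A proper edge coloring of a graph $G$ is an assignment of colors to the edges of $G$ such that no two adjacent edges (edges incident to a common vertex) receive the same color. A star edge coloring of $G$ is a proper edge coloring of $G$ such that no path with four edges and no cycle with four edges in $G$ is bicolored; that is, every path of length four and every cycle of length four in $G$ uses at least three different colors. The star chromatic index $\chi'_s(G)$ is the minimum integer $k$ such that $G$ admits a star edge coloring with $k$ colors. A Halin graph $G$ is a plane graph consisting of a tree $T$ and a cycle $C$, where each vertex of $T$ is either of degree $1$ in $T$ (a leaf) or of degree at least $3$ in $T$, and $C$ connects the leaves of $T$ (the vertices of $C$ are exactly the leaves of $T$) in such a way that $C$ is the boundary of the exterior face. The tree $T$ is called the characteristic tree and $C$ the adjoint cycle of $G$, and one writes $G = T\cup C$. *)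

theory Defs
  imports "HOL-Analysis.Analysis"
begin

definition simple_graph :: "'a set \<Rightarrow> 'a set set \<Rightarrow> bool" where
  "simple_graph V E \<longleftrightarrow> finite V \<and> (\<forall>e\<in>E. e \<subseteq> V \<and> card e = 2)"

definition vdegree :: "'a set set \<Rightarrow> 'a \<Rightarrow> nat" where
  "vdegree E v = card {e \<in> E. v \<in> e}"

definition regular :: "nat \<Rightarrow> 'a set \<Rightarrow> 'a set set \<Rightarrow> bool" where
  "regular d V E \<longleftrightarrow> (\<forall>v\<in>V. vdegree E v = d)"

text \<open>Paths and cycles are given by the list of their vertices; the edge joining the last
  vertex of a cycle to the first one is implicit. A path has one edge less than vertices.\<close>

definition path_edges :: "'a list \<Rightarrow> 'a set set" where
  "path_edges p = {{p ! i, p ! Suc i} | i. Suc i < length p}"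

definition cycle_edges :: "'a list \<Rightarrow> 'a set set" where
  "cycle_edges p = {{p ! i, p ! (Suc i mod length p)} | i. i < length p}"

definition graph_path :: "'a set \<Rightarrow> 'a set set \<Rightarrow> 'a list \<Rightarrow> bool" where
  "graph_path V E p \<longleftrightarrow> p \<noteq> [] \<and> distinct p \<and> set p \<subseteq> V \<and> path_edges p \<subseteq> E"

definition graph_cycle :: "'a set \<Rightarrow> 'a set set \<Rightarrow> 'a list \<Rightarrow> bool" where
  "graph_cycle V E p \<longleftrightarrow> 3 \<le> length p \<and> distinct p \<and> set p \<subseteq> V \<and> cycle_edges p \<subseteq> E"

definition graph_connected :: "'a set \<Rightarrow> 'a set set \<Rightarrow> bool" where
  "graph_connected V E \<longleftrightarrow>
     V \<noteq> {} \<and> (\<forall>u\<in>V. \<forall>v\<in>V. \<exists>p. graph_path V E p \<and> hd p = u \<and> last p = v)"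

definition tree :: "'a set \<Rightarrow> 'a set set \<Rightarrow> bool" where
  "tree V E \<longleftrightarrow> simple_graph V E \<and> graph_connected V E \<and> (\<nexists>p. graph_cycle V E p)"

definition leaves :: "'a set \<Rightarrow> 'a set set \<Rightarrow> 'a set" where
  "leaves V E = {v \<in> V. vdegree E v = 1}"

definition cycle_graph :: "'a set \<Rightarrow> 'a set set \<Rightarrow> bool" where
  "cycle_graph V E \<longleftrightarrow> (\<exists>p. 3 \<le> length p \<and> distinct p \<and> set p = V \<and> cycle_edges p = E)"

text \<open>A plane graph is an abstract graph with a drawing: \<open>pos\<close> places the vertices, and
  \<open>\<gamma>\<close> sends every edge to an arc (an injective path, with either orientation).\<close>

definition plane_graph ::
    "'a set \<Rightarrow> 'a set set \<Rightarrow> ('a \<Rightarrow> complex) \<Rightarrow> ('a set \<Rightarrow> real \<Rightarrow> complex) \<Rightarrow> bool" where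
  "plane_graph V E pos \<gamma> \<longleftrightarrow>
     simple_graph V E \<and> inj_on pos V \<and>
     (\<forall>e\<in>E. arc (\<gamma> e) \<and> {pathstart (\<gamma> e), pathfinish (\<gamma> e)} = pos ` e \<and>
            path_image (\<gamma> e) \<inter> pos ` V = pos ` e) \<and>
     (\<forall>e\<in>E. \<forall>f\<in>E. e \<noteq> f \<longrightarrow> path_image (\<gamma> e) \<inter> path_image (\<gamma> f) = pos ` (e \<inter> f))"

definition drawing ::
    "'a set \<Rightarrow> 'a set set \<Rightarrow> ('a \<Rightarrow> complex) \<Rightarrow> ('a set \<Rightarrow> real \<Rightarrow> complex) \<Rightarrow> complex set" where
  "drawing V E pos \<gamma> = pos ` V \<union> (\<Union>e\<in>E. path_image (\<gamma> e))"

text \<open>\<open>T\<close> and \<open>C\<close> are the edge sets of the characteristic tree and of the adjoint cycle.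
  The tree spans all of \<open>V\<close>. Since the drawing is compact, its complement has exactly one
  unbounded component, so \<^const>\<open>outside\<close> is the exterior face.\<close>

definition halin_graph ::
    "'a set \<Rightarrow> 'a set set \<Rightarrow> 'a set set \<Rightarrow> ('a \<Rightarrow> complex) \<Rightarrow> ('a set \<Rightarrow> real \<Rightarrow> complex) \<Rightarrow> bool"
  where
  "halin_graph V T C pos \<gamma> \<longleftrightarrow>
     plane_graph V (T \<union> C) pos \<gamma> \<and>
     tree V T \<and> (\<forall>v\<in>V. vdegree T v = 1 \<or> 3 \<le> vdegree T v) \<and>
     cycle_graph (leaves V T) C \<and>
     frontier (outside (drawing V (T \<union> C) pos \<gamma>)) = drawing (leaves V T) C pos \<gamma>"

definition proper_edge_coloring :: "'a set set \<Rightarrow> ('a set \<Rightarrow> 'c) \<Rightarrow> bool" where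
  "proper_edge_coloring E c \<longleftrightarrow> (\<forall>e\<in>E. \<forall>f\<in>E. e \<noteq> f \<and> e \<inter> f \<noteq> {} \<longrightarrow> c e \<noteq> c f)"

definition star_edge_coloring :: "'a set \<Rightarrow> 'a set set \<Rightarrow> ('a set \<Rightarrow> 'c) \<Rightarrow> bool" where
  "star_edge_coloring V E c \<longleftrightarrow>
     proper_edge_coloring E c \<and>
     (\<forall>p. graph_path V E p \<and> length p = 5 \<longrightarrow> 3 \<le> card (c ` path_edges p)) \<and>
     (\<forall>p. graph_cycle V E p \<and> length p = 4 \<longrightarrow> 3 \<le> card (c ` cycle_edges p))"

text \<open>The minimum exists for every finite graph: a coloring that is injective on the edges
  is a star edge coloring.\<close>

definition star_chromatic_index :: "'a set \<Rightarrow> 'a set set \<Rightarrow> nat" where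
  "star_chromatic_index V E =
     (LEAST k. \<exists>c :: 'a set \<Rightarrow> nat. star_edge_coloring V E c \<and> c ` E \<subseteq> {..<k})"

end

theory Submission imports Defs
begin

text \<open>
  A bicoloured path or cycle with four edges is visible from its middle vertex. Let an end
  \<open>y\<close> of an edge \<open>xy\<close> \<^emph>\<open>show\<close> to \<open>x\<close>
  the colours of the other edges at \<open>y\<close>. Then two edges \<open>xy\<close> and
  \<open>xz\<close> are the middle of a bicoloured path or cycle exactly if \<open>y\<close> shows
  the colour of \<open>xz\<close> and \<open>z\<close> shows the colour of \<open>xy\<close>.
  Being a star edge colouring is therefore a condition at each vertex that involves, for every
  incident edge, only its colour and what is shown across it (\<open>star_edge_coloringI\<close>).

  Cut a cubic Halin graph at a leaf \<open>r\<close> of its characteristic tree. The rest of the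
  tree is a binary tree, and by planarity its children can be ordered such that its leaves, from
  left to right, follow the adjoint cycle from \<open>r\<close> back to \<open>r\<close>
  (\<open>cubic_halin_closed_tree\<close>). Indeed, the leaves in a branch of the tree are
  consecutive on the cycle: otherwise two disjoint paths of the tree, one in the branch and one
  outside it, would connect two interleaved pairs of points of the closed curve \<open>C\<close>;
  both run inside \<open>C\<close>, because the outside of \<open>C\<close> is the exterior face,
  and a chord of a Jordan curve separates its inside (\<open>no_interleaved_paths\<close>,
  \<open>branch_interval\<close>).

  After that the problem is about binary trees. A subtree together with the part of the cycle
  along its leaves is attached to the rest of the graph by only three edges: the one above its
  apex, and the cycle edges to the left and to the right of its leaves. A subtree that is not a
  leaf consists of its apex and of two smaller pieces, which share the cycle edge between them. So
  one can colour from the root downwards: prescribe for a piece the colours of its three outer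
  edges, what the rest of the graph shows across them, and what the piece has to show in return,
  and split such a demand into one for each child. With six colours there is a finite set of
  demands, thirteen up to renaming the colours, that is closed under splitting: each of them can
  be met on a tree with two leaves, and on a larger tree it can be split into demands of the same
  set, whichever of the children are leaves (\<open>demand_split\<close>). Hence every binary tree
  with at least two leaves meets all thirteen demands. One of them fits the way in which the three
  outer edges of the whole tree come together at \<open>r\<close>, which completes the colouring
  (\<open>colourable_imp_closes\<close>, \<open>colour_closed_tree\<close>).
\<close>

section \<open>Paths as lists of vertices\<close>

lemma path_edges_Cons: "path_edges (x # y # zs) = insert {x, y} (path_edges (y # zs))"
proof (intro subset_antisym subsetI)
  fix e assume "e \<in> path_edges (x # y # zs)"
  then obtain i where i: "e = {(x # y # zs) ! i, (x # y # zs) ! Suc i}" "Suc i < length (x # y # zs)"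
    unfolding path_edges_def by blast
  show "e \<in> insert {x, y} (path_edges (y # zs))"
  proof (cases i)
    case (Suc j)
    then have "e = {(y # zs) ! j, (y # zs) ! Suc j} \<and> Suc j < length (y # zs)" using i by simp
    then show ?thesis unfolding path_edges_def by blast
  qed (use i in simp)
next
  fix e assume e: "e \<in> insert {x, y} (path_edges (y # zs))"
  show "e \<in> path_edges (x # y # zs)"
  proof (cases "e = {x, y}")
    case True
    then have "e = {(x # y # zs) ! 0, (x # y # zs) ! Suc 0} \<and> Suc 0 < length (x # y # zs)" by simp
    then show ?thesis unfolding path_edges_def by blast
  next
    case False
    then obtain i where "e = {(y # zs) ! i, (y # zs) ! Suc i}" "Suc i < length (y # zs)"
      using e unfolding path_edges_def by blast
    then have "e = {(x # y # zs) ! Suc i, (x # y # zs) ! Suc (Suc i)} \<and> Suc (Suc i) < length (x # y # zs)"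
      by simp
    then show ?thesis unfolding path_edges_def by blast
  qed
qed

lemma path_edges_single [simp]: "path_edges [x] = {}" "path_edges [] = {}"
  by (auto simp: path_edges_def)

lemma Union_path_edges: "2 \<le> length p \<Longrightarrow> \<Union> (path_edges p) = set p"
proof (induction p rule: induct_list012)
  case (3 x y zs)
  then show ?case by (cases zs) (auto simp: path_edges_Cons)
qed auto

lemma Union_path_edges_subset: "\<Union> (path_edges p) \<subseteq> set p"
  by (cases "2 \<le> length p") (use Union_path_edges in \<open>force simp: path_edges_def\<close>)+

lemma path_edges_append: "path_edges (xs @ [y]) \<union> path_edges (y # zs) = path_edges (xs @ y # zs)"
proof (induction xs)
  case (Cons x xs)
  then show ?case by (cases xs) (auto simp: path_edges_Cons)
qed simp

lemma path_edges_rev: "path_edges (rev p) = path_edges p"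
proof (induction p rule: induct_list012)
  case (3 x y zs)
  have "path_edges (rev (x # y # zs)) = path_edges (rev zs @ [y] @ [x])" by simp
  also have "\<dots> = path_edges (rev zs @ [y]) \<union> path_edges [y, x]"
    using path_edges_append[of "rev zs" y "[x]"] by simp
  finally show ?case using 3 by (auto simp: path_edges_Cons insert_commute)
qed auto

lemma cycle_edges_Cons: "cycle_edges (x # xs) = path_edges (x # xs @ [x])"
proof -
  have eq: "{(x # xs) ! i, (x # xs) ! (Suc i mod length (x # xs))} =
    {(x # xs @ [x]) ! i, (x # xs @ [x]) ! Suc i}" if "i < length (x # xs)" for i
  proof -
    have "(x # xs) ! i = (x # xs @ [x]) ! i"
      using that by (metis append_Cons nth_append)
    moreover have "(x # xs) ! (Suc i mod length (x # xs)) = (x # xs @ [x]) ! Suc i"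
    proof (cases "Suc i = length (x # xs)")
      case True
      then show ?thesis by (simp add: nth_append)
    next
      case False
      then have "Suc i < length (x # xs)" using that by simp
      then show ?thesis by (simp add: nth_append)
    qed
    ultimately show ?thesis by simp
  qed
  have "cycle_edges (x # xs) = (\<lambda>i. {(x # xs) ! i, (x # xs) ! (Suc i mod length (x # xs))}) ` {..<length (x # xs)}"
    unfolding cycle_edges_def by blast
  also have "\<dots> = (\<lambda>i. {(x # xs @ [x]) ! i, (x # xs @ [x]) ! Suc i}) ` {..<length (x # xs)}"
    using eq by (intro image_cong) auto
  also have "\<dots> = path_edges (x # xs @ [x])"
    unfolding path_edges_def by auto
  finally show ?thesis .
qed

section \<open>Disjoint chords of a Jordan curve\<close>

text \<open>
  The arcs \<open>c1\<close> and \<open>c2\<close> form a Jordan curve, and \<open>c\<close> and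
  \<open>d\<close> are disjoint chords of it whose ends interleave. The chord \<open>c\<close>
  splits the inside into one part bounded by \<open>c1\<close> and \<open>c\<close> and one
  bounded by \<open>c2\<close> and \<open>c\<close>. The chord \<open>d\<close> stays in one of
  them, yet it starts on \<open>c1\<close> and ends on \<open>c2\<close>.
\<close>

lemma disjoint_chords_False:
  fixes c1 c2 c d :: "real \<Rightarrow> complex"
  assumes arcs: "arc c1" "arc c2" "arc c" "arc d"
    and ends: "pathstart c1 = a" "pathfinish c1 = b" "pathstart c2 = a" "pathfinish c2 = b"
      "pathstart c = a" "pathfinish c = b"
    and c12: "path_image c1 \<inter> path_image c2 = {a, b}"
    and c1c: "path_image c1 \<inter> path_image c = {a, b}"
    and c2c: "path_image c2 \<inter> path_image c = {a, b}"
    and dc: "path_image d \<inter> path_image c = {}"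
    and d: "path_image d \<inter> (path_image c1 \<union> path_image c2) = {pathstart d, pathfinish d}"
    and d1: "pathstart d \<in> path_image c1" and d2: "pathfinish d \<in> path_image c2"
    and out: "path_image c \<inter> outside (path_image c1 \<union> path_image c2) = {}"
      "path_image d \<inter> outside (path_image c1 \<union> path_image c2) = {}"
  shows False
proof -
  let ?J = "path_image c1 \<union> path_image c2"
  let ?I1 = "inside (path_image c1 \<union> path_image c)" and ?I2 = "inside (path_image c2 \<union> path_image c)"
  have ab: "a \<noteq> b" using arc_distinct_ends[OF arcs(1)] ends by simp
  have sp: "simple_path c1" "simple_path c2" "simple_path c" "simple_path d"
    using arcs by (auto simp: arc_imp_simple_path)
  have io: "x \<in> inside ?J \<or> x \<in> outside ?J" if "x \<notin> ?J" for x
    using that union_with_inside[of ?J] by auto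
  have c0: "path_image c - {a, b} \<noteq> {}"
    using nonempty_simple_path_endless[OF sp(3)] ends by simp
  have "path_image c - {a, b} \<subseteq> inside ?J"
    using io out(1) c1c c2c by blast
  then have "path_image c \<inter> inside ?J \<noteq> {}" using c0 by blast
  then have I: "?I1 \<inter> ?I2 = {}" "?I1 \<union> ?I2 \<union> (path_image c - {a, b}) = inside ?J"
    using split_inside_simple_closed_curve[OF sp(1) ends(1,2) sp(2) ends(3,4) sp(3) ends(5,6) ab c12 c1c c2c]
    by blast+
  define D where "D = path_image d - {pathstart d, pathfinish d}"
  have D: "D = d ` {0<..<1}" using simple_path_endless[OF sp(4)] unfolding D_def .
  have "continuous_on {0..1} d" using arc_imp_path[OF arcs(4)] by (simp add: path_def)
  then have "d ` closure {0<..<1} \<subseteq> closure (d ` {0<..<1})"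
    by (intro image_closure_subset) (auto intro: closure_subset[THEN subsetD])
  then have clD: "path_image d \<subseteq> closure D" unfolding D path_image_def by simp
  have conn: "connected D" using connected_simple_path_endless[OF sp(4)] unfolding D_def .
  have D0: "D \<noteq> {}" using nonempty_simple_path_endless[OF sp(4)] unfolding D_def .
  have "D \<subseteq> inside ?J"
    using io out(2) d unfolding D_def by blast
  then have sub: "D \<subseteq> ?I1 \<union> ?I2" using I(2) dc unfolding D_def by blast
  have cl: "closed (path_image c1 \<union> path_image c)" "closed (path_image c2 \<union> path_image c)"
    using sp by (auto intro!: closed_Un closed_simple_path_image)
  have op: "open ?I1" "open ?I2" using cl by (auto intro: open_inside)
  have noJ: "inside ?J \<inter> ?J = {}" using inside_no_overlap by blast
  have sJ: "pathstart d \<in> ?J" "pathfinish d \<in> ?J" using d1 d2 by auto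
    \<comment> \<open>Without its ends, \<open>d\<close> is connected and avoids \<open>c\<close>, so it lies in one of the two parts.\<close>
  have "D \<inter> ?I1 = {} \<or> D \<inter> ?I2 = {}"
    using connectedD[OF conn op] I(1) sub by blast
  then consider "D \<subseteq> ?I2" | "D \<subseteq> ?I1" using sub by blast
  then show False
  proof cases
    case 1
    have "pathstart d \<in> closure ?I2"
      using clD closure_mono[OF 1] pathstart_in_path_image[of d] by blast
    then have "pathstart d \<in> ?I2 \<union> (path_image c2 \<union> path_image c)"
      using closure_inside_subset[OF cl(2)] by blast
    then have "pathstart d \<in> path_image c2"
      using sJ noJ I(2) dc pathstart_in_path_image[of d] by blast
    then have "pathstart d \<in> {a, b}" using d1 c12 by blast
    then show False using dc pathstart_in_path_image[of d] c1c by blast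
  next
    case 2
    have "pathfinish d \<in> closure ?I1"
      using clD closure_mono[OF 2] pathfinish_in_path_image[of d] by blast
    then have "pathfinish d \<in> ?I1 \<union> (path_image c1 \<union> path_image c)"
      using closure_inside_subset[OF cl(1)] by blast
    then have "pathfinish d \<in> path_image c1"
      using sJ noJ I(2) dc pathfinish_in_path_image[of d] by blast
    then have "pathfinish d \<in> {a, b}" using d2 c12 by blast
    then show False using dc pathfinish_in_path_image[of d] c1c by blast
  qed
qed

text \<open>
  For a drawing \<open>D\<close> whose exterior face has the closed curve \<open>J\<close> as its
  boundary, the exterior face is all of the outside of \<open>J\<close>: the latter is connected
  and cannot be left without crossing the boundary.
\<close>

lemma disjoint_outside:
  fixes D J :: "complex set"
  assumes "compact D" "J \<subseteq> D" "frontier (outside D) = J" "connected (outside J)"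
  shows "D \<inter> outside J = {}"
proof -
  have ne: "outside D \<noteq> {}" using outside_bounded_nonempty compact_imp_bounded[OF assms(1)] by blast
  have sub: "outside D \<subseteq> outside J" using outside_mono[OF assms(2)] .
  have "outside J \<inter> frontier (outside D) = {}"
    using assms(3) outside_no_overlap by blast
  then have "outside J - outside D = {}"
    using connected_Int_frontier[OF assms(4), of "outside D"] ne sub by blast
  then show ?thesis using outside_no_overlap[of D] by blast
qed

section \<open>Interleaved paths in a plane graph\<close>

lemma plane_edge_arc:
  assumes "plane_graph V E pos \<gamma>" "{x, y} \<in> E"
  shows "\<exists>g. arc g \<and> pathstart g = pos x \<and> pathfinish g = pos y \<and> path_image g = path_image (\<gamma> {x, y})"
proof -
  have "arc (\<gamma> {x, y})" "{pathstart (\<gamma> {x, y}), pathfinish (\<gamma> {x, y})} = {pos x, pos y}"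
    using assms unfolding plane_graph_def by auto
  then have "pathstart (\<gamma> {x, y}) = pos x \<and> pathfinish (\<gamma> {x, y}) = pos y \<or>
      pathstart (\<gamma> {x, y}) = pos y \<and> pathfinish (\<gamma> {x, y}) = pos x"
    by (auto simp: doubleton_eq_iff)
  then show ?thesis using \<open>arc (\<gamma> {x, y})\<close>
    by (elim disjE) (auto intro: exI[of _ "\<gamma> {x, y}"] exI[of _ "reversepath (\<gamma> {x, y})"] arc_reversepath)
qed

lemma plane_edges_Int:
  assumes "plane_graph V E pos \<gamma>" "e \<in> E" "f \<in> E" "e \<noteq> f"
  shows "path_image (\<gamma> e) \<inter> path_image (\<gamma> f) = pos ` (e \<inter> f)"
  using assms unfolding plane_graph_def by simp

lemma plane_path_arc:
  assumes pl: "plane_graph V E pos \<gamma>"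
    and "path_edges p \<subseteq> E" "distinct p" "2 \<le> length p"
  shows "\<exists>g. arc g \<and> pathstart g = pos (hd p) \<and> pathfinish g = pos (last p) \<and>
    path_image g = (\<Union>e\<in>path_edges p. path_image (\<gamma> e))"
  using assms(2-)
proof (induction p rule: induct_list012)
  case (3 x y zs)
  have xy: "{x, y} \<in> E" and E': "path_edges (y # zs) \<subseteq> E" using 3 by (auto simp: path_edges_Cons)
  obtain g1 where g1: "arc g1" "pathstart g1 = pos x" "pathfinish g1 = pos y"
    "path_image g1 = path_image (\<gamma> {x, y})"
    using plane_edge_arc[OF pl xy] by blast
  show ?case
  proof (cases zs)
    case Nil
    then show ?thesis using g1 by (intro exI[of _ g1]) (auto simp: path_edges_Cons)
  next
    case (Cons z zs')
    obtain g2 where g2: "arc g2" "pathstart g2 = pos y" "pathfinish g2 = pos (last (y # zs))"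
      "path_image g2 = (\<Union>e\<in>path_edges (y # zs). path_image (\<gamma> e))"
      using "3.IH"(2) E' 3(4,5) Cons by auto
    have "path_image g1 \<inter> path_image g2 \<subseteq> {pos y}"
    proof -
      have "path_image (\<gamma> {x, y}) \<inter> path_image (\<gamma> f) \<subseteq> {pos y}" if f: "f \<in> path_edges (y # zs)" for f
      proof -
        have "x \<notin> f" using f Union_path_edges_subset[of "y # zs"] 3(4) by auto
        then have "{x, y} \<noteq> f" "{x, y} \<inter> f \<subseteq> {y}" by auto
        moreover have "path_image (\<gamma> {x, y}) \<inter> path_image (\<gamma> f) = pos ` ({x, y} \<inter> f)"
          by (rule plane_edges_Int[OF pl xy _ \<open>{x, y} \<noteq> f\<close>]) (use f E' in blast)
        ultimately show ?thesis by auto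
      qed
      then show ?thesis using g1 g2 by auto
    qed
    then have "arc (g1 +++ g2)" using g1 g2 by (intro arc_join) auto
    moreover have "path_image (g1 +++ g2) = path_image g1 \<union> path_image g2"
      using g1 g2 by (simp add: path_image_join)
    ultimately show ?thesis using g1 g2 by (intro exI[of _ "g1 +++ g2"]) (auto simp: path_edges_Cons)
  qed
qed auto

lemma plane_vertex_on_edge:
  assumes "plane_graph V E pos \<gamma>" "e \<in> E" "v \<in> e"
  shows "pos v \<in> path_image (\<gamma> e)"
proof -
  have "path_image (\<gamma> e) \<inter> pos ` V = pos ` e" using assms(1,2) unfolding plane_graph_def by auto
  then show ?thesis using assms(3) by blast
qed

lemma plane_Int:
  assumes pl: "plane_graph V E pos \<gamma>" and "F \<subseteq> E" "G \<subseteq> E" "F \<inter> G = {}"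
  shows "(\<Union>e\<in>F. path_image (\<gamma> e)) \<inter> (\<Union>e\<in>G. path_image (\<gamma> e)) = pos ` (\<Union>F \<inter> \<Union>G)"
proof -
  have in_im: "pos v \<in> path_image (\<gamma> e)" if "e \<in> E" "v \<in> e" for v e
    using plane_vertex_on_edge[OF pl] that .
  have "path_image (\<gamma> e) \<inter> path_image (\<gamma> f) = pos ` (e \<inter> f)" if "e \<in> F" "f \<in> G" for e f
  proof -
    have "e \<noteq> f" "e \<in> E" "f \<in> E" using that assms by auto
    then show ?thesis by (intro plane_edges_Int[OF pl])
  qed
  then have "(\<Union>e\<in>F. path_image (\<gamma> e)) \<inter> (\<Union>e\<in>G. path_image (\<gamma> e)) \<subseteq> pos ` (\<Union>F \<inter> \<Union>G)"
    by blast
  moreover have "pos ` (\<Union>F \<inter> \<Union>G) \<subseteq> (\<Union>e\<in>F. path_image (\<gamma> e)) \<inter> (\<Union>e\<in>G. path_image (\<gamma> e))"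
    using in_im assms(2,3) by blast
  ultimately show ?thesis by blast
qed

text \<open>
  The lists \<open>xs\<close> and \<open>ys\<close> are the vertices on the two sides of
  \<open>C\<close> between \<open>a\<close> and \<open>b\<close>. The path \<open>q\<close> of
  \<open>T\<close> connects \<open>a\<close> and \<open>b\<close>, and \<open>d\<close> connects
  one side to the other.
\<close>

lemma no_interleaved_paths:
  assumes pl: "plane_graph V (T \<union> C) pos \<gamma>" and TC: "T \<inter> C = {}"
    and C: "C = cycle_edges (a # xs @ b # ys)" "distinct (a # xs @ b # ys)"
    and fr: "frontier (outside (drawing V (T \<union> C) pos \<gamma>)) = drawing (set (a # xs @ b # ys)) C pos \<gamma>"
    and q: "distinct q" "path_edges q \<subseteq> T" "hd q = a" "last q = b" "q \<noteq> []"
      "set q \<inter> set (a # xs @ b # ys) = {a, b}"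
    and d: "distinct d" "path_edges d \<subseteq> T" "hd d \<in> set xs" "last d \<in> set ys" "d \<noteq> []"
      "set d \<inter> set (a # xs @ b # ys) = {hd d, last d}"
    and dq: "set d \<inter> set q = {}"
  shows False
proof -
  let ?p1 = "a # xs @ [b]" and ?p2 = "a # rev ys @ [b]"
  let ?D = "\<lambda>F. \<Union>e\<in>F. path_image (\<gamma> e)"
  have ab: "a \<noteq> b" using C(2) by auto
  have xy: "xs \<noteq> []" "ys \<noteq> []" using d(3,4) by auto
  have fin: "finite V" "\<forall>e\<in>T \<union> C. e \<subseteq> V" using pl unfolding plane_graph_def simple_graph_def by auto
  have p2: "path_edges ?p2 = path_edges (b # ys @ [a])"
    using path_edges_rev[of "b # ys @ [a]"] by simp
  have CC: "C = path_edges ?p1 \<union> path_edges ?p2"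
    unfolding C(1) p2 cycle_edges_Cons using path_edges_append[of "a # xs" b "ys @ [a]"] by simp
  \<comment> \<open>The two sides share only \<open>a\<close> and \<open>b\<close>, and \<open>xs\<close> keeps these from being adjacent in \<open>p1\<close>.\<close>
  have disj: "path_edges ?p1 \<inter> path_edges ?p2 = {}"
  proof (rule ccontr)
    assume "path_edges ?p1 \<inter> path_edges ?p2 \<noteq> {}"
    then obtain e where e: "e \<in> path_edges ?p1" "e \<in> path_edges ?p2" by blast
    then have "e \<subseteq> set ?p1 \<inter> set ?p2" 
      using Union_path_edges_subset[of ?p1] Union_path_edges_subset[of ?p2] by blast
    then have sub: "e \<subseteq> {a, b}" using C(2) by auto
    obtain x xs' where xs: "xs = x # xs'" using xy by (cases xs) auto
    have "e \<in> C" using e CC by blast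
    then have "card e = 2" using pl unfolding plane_graph_def simple_graph_def by auto
    then have "e = {a, b}" using sub ab by (metis card_2_iff card_subset_eq finite.intros)
    then have "{a, b} = {a, x} \<or> {a, b} \<in> path_edges (x # xs' @ [b])"
      using e(1) xs by (auto simp: path_edges_Cons)
    moreover have "x \<noteq> b" "a \<notin> set (x # xs' @ [b])" using C(2) xs by auto
    moreover have "\<Union> (path_edges (x # xs' @ [b])) \<subseteq> set (x # xs' @ [b])"
      by (rule Union_path_edges_subset)
    ultimately show False by (auto simp: doubleton_eq_iff)
  qed
  have U: "\<Union> (path_edges ?p1) = set ?p1" "\<Union> (path_edges ?p2) = set ?p2"
    by (rule Union_path_edges, simp)+
  have lq: "2 \<le> length q" using q(3-5) ab by (cases q; cases "tl q") auto
  have hl: "hd d \<noteq> last d" using d(3,4) C(2) by auto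
  then have ld: "2 \<le> length d" using d(5) by (cases d; cases "tl d") auto
  have Uq: "\<Union> (path_edges q) = set q" and Ud: "\<Union> (path_edges d) = set d"
    using Union_path_edges lq ld by auto
  have UC: "\<Union> C = set (a # xs @ b # ys)" unfolding CC Union_Un_distrib U by auto
  obtain c1 where c1: "arc c1" "pathstart c1 = pos a" "pathfinish c1 = pos b" "path_image c1 = ?D (path_edges ?p1)"
    using plane_path_arc[OF pl, of ?p1] CC C(2) by auto
  obtain c2 where c2: "arc c2" "pathstart c2 = pos a" "pathfinish c2 = pos b" "path_image c2 = ?D (path_edges ?p2)"
    using plane_path_arc[OF pl, of ?p2] CC C(2) by auto
  obtain c where c: "arc c" "pathstart c = pos a" "pathfinish c = pos b" "path_image c = ?D (path_edges q)"
    using plane_path_arc[OF pl, of q] q lq by auto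
  obtain \<delta> where \<delta>: "arc \<delta>" "pathstart \<delta> = pos (hd d)" "pathfinish \<delta> = pos (last d)" "path_image \<delta> = ?D (path_edges d)"
    using plane_path_arc[OF pl, of d] d ld by auto
  have J: "path_image c1 \<union> path_image c2 = ?D C" unfolding c1 c2 CC by blast
  have I: "?D F \<inter> ?D G = pos ` (\<Union>F \<inter> \<Union>G)" if "F \<subseteq> T \<union> C" "G \<subseteq> T \<union> C" "F \<inter> G = {}" for F G
    using plane_Int[OF pl that] .
  have c12: "path_image c1 \<inter> path_image c2 = {pos a, pos b}"
  proof -
    have "set ?p1 \<inter> set ?p2 = {a, b}" using C(2) by auto
    then show ?thesis unfolding c1 c2 using I[OF _ _ disj] CC U by auto
  qed
  have qp: "path_edges q \<inter> path_edges ?p1 = {}" "path_edges q \<inter> path_edges ?p2 = {}"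
    "path_edges d \<inter> C = {}" using q(2) d(2) TC CC by blast+
  have qd: "path_edges d \<inter> path_edges q = {}"
  proof -
    have "e \<noteq> {}" if "e \<in> path_edges d" for e using that unfolding path_edges_def by auto
    then show ?thesis using Ud Uq dq by blast
  qed
  have c1c: "path_image c1 \<inter> path_image c = {pos a, pos b}"
  proof -
    have "set q \<inter> set ?p1 = {a, b}" using q(6) by auto
    then show ?thesis unfolding c1 c using I[OF _ _ qp(1)] q(2) CC Uq U by auto
  qed
  have c2c: "path_image c2 \<inter> path_image c = {pos a, pos b}"
  proof -
    have "set q \<inter> set ?p2 = {a, b}" using q(6) by auto
    then show ?thesis unfolding c2 c using I[OF _ _ qp(2)] q(2) CC Uq U by auto
  qed
  have dc: "path_image \<delta> \<inter> path_image c = {}"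
    unfolding \<delta> c using I[OF _ _ qd] q(2) d(2) Ud Uq dq by auto
  have dJ: "path_image \<delta> \<inter> (path_image c1 \<union> path_image c2) = {pathstart \<delta>, pathfinish \<delta>}"
    unfolding J \<delta> using I[OF _ _ qp(3)] d(2,6) Ud UC by auto
  have mem: "pathstart \<delta> \<in> path_image c1" "pathfinish \<delta> \<in> path_image c2"
  proof -
    have "pos v \<in> ?D (path_edges p)" if p: "v \<in> set p" "path_edges p \<subseteq> T \<union> C" "2 \<le> length p" for v p
    proof -
      obtain e where "e \<in> path_edges p" "v \<in> e" using Union_path_edges[OF p(3)] p(1) by blast
      then have "pos v \<in> path_image (\<gamma> e)" using plane_vertex_on_edge[OF pl] p(2) by blast
      then show ?thesis using \<open>e \<in> path_edges p\<close> by blast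
    qed
    from this[of "hd d" ?p1] this[of "last d" ?p2] show "pathstart \<delta> \<in> path_image c1" "pathfinish \<delta> \<in> path_image c2"
      unfolding \<delta> c1 c2 using d(3,4) CC by auto
  qed
  let ?Dr = "drawing V (T \<union> C) pos \<gamma>"
  have posJ: "pos ` set (a # xs @ b # ys) \<subseteq> ?D C"
  proof
    fix z assume "z \<in> pos ` set (a # xs @ b # ys)"
    then obtain v e where "z = pos v" "e \<in> C" "v \<in> e" using UC by blast
    then have "z \<in> path_image (\<gamma> e)" using plane_vertex_on_edge[OF pl, of e v] by simp
    then show "z \<in> ?D C" using \<open>e \<in> C\<close> by blast
  qed
  have frJ: "frontier (outside ?Dr) = path_image c1 \<union> path_image c2"
    unfolding fr J using Un_absorb1[OF posJ] by (simp only: drawing_def)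
  have "T \<union> C \<subseteq> Pow V" using fin(2) by blast
  then have finE: "finite (T \<union> C)" using fin(1) by (meson finite_Pow_iff finite_subset)
  have "compact (path_image (\<gamma> e))" if "e \<in> T \<union> C" for e
  proof -
    have "arc (\<gamma> e)" using pl that unfolding plane_graph_def by auto
    then show ?thesis by (simp add: arc_imp_path compact_path_image)
  qed
  then have "compact (?D (T \<union> C))" by (intro compact_UN[OF finE]) blast
  then have comp: "compact ?Dr"
    unfolding drawing_def using fin(1) by (intro compact_Un finite_imp_compact[OF finite_imageI])
  have "simple_path (c1 +++ reversepath c2)"
    using c1(1-3) c2(1-3) c12 by (intro simple_path_join_loop) (simp_all add: arc_reversepath)
  then have "connected (outside (path_image (c1 +++ reversepath c2)))"
    using Jordan_inside_outside[of "c1 +++ reversepath c2"] c1(2) c2(2) by simp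
  moreover have "path_image (c1 +++ reversepath c2) = path_image c1 \<union> path_image c2"
    using c1(3) c2(3) by (simp add: path_image_join)
  ultimately have conn: "connected (outside (path_image c1 \<union> path_image c2))" by simp
  have "path_image c1 \<union> path_image c2 \<subseteq> ?Dr" unfolding J drawing_def by blast
  \<comment> \<open>The exterior face is the whole outside of the curve \<open>C\<close>, so both chords run inside.\<close>
  then have O: "?Dr \<inter> outside (path_image c1 \<union> path_image c2) = {}"
    using disjoint_outside[OF comp _ frJ conn] by blast
  have "path_image c \<subseteq> ?Dr" "path_image \<delta> \<subseteq> ?Dr"
    unfolding c(4) \<delta>(4) drawing_def using q(2) d(2) by blast+
  then show False
    using disjoint_chords_False[OF c1(1) c2(1) c(1) \<delta>(1) c1(2,3) c2(2,3) c(2,3) c12 c1c c2c dc dJ mem] O by blast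
qed

section \<open>Star edge colourings checked at the vertices\<close>

text \<open>
  Two edges of colours \<open>p\<close> and \<open>q\<close> meet at a vertex, and
  \<open>S\<close> and \<open>T\<close> are the colours shown across them. They are safe if they
  are not the middle of a bicoloured path or cycle.
\<close>

definition safe :: "nat \<Rightarrow> nat set \<Rightarrow> nat \<Rightarrow> nat set \<Rightarrow> bool" where
  "safe p S q T \<longleftrightarrow> p \<noteq> q \<and> \<not> (q \<in> S \<and> p \<in> T)"

definition safe3 :: "nat \<Rightarrow> nat set \<Rightarrow> nat \<Rightarrow> nat set \<Rightarrow> nat \<Rightarrow> nat set \<Rightarrow> bool" where
  "safe3 p S q T r U \<longleftrightarrow> safe p S q T \<and> safe p S r U \<and> safe q T r U"

definition nbrs :: "'a set set \<Rightarrow> 'a \<Rightarrow> 'a set" where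
  "nbrs T v = {y. {v, y} \<in> T}"

definition seen :: "'a set set \<Rightarrow> ('a set \<Rightarrow> nat) \<Rightarrow> 'a \<Rightarrow> 'a \<Rightarrow> nat set" where
  "seen E c x y = {c {y, z} | z. {y, z} \<in> E \<and> z \<noteq> x}"

definition vertex_ok :: "'a set set \<Rightarrow> ('a set \<Rightarrow> nat) \<Rightarrow> 'a \<Rightarrow> bool" where
  "vertex_ok E c x \<longleftrightarrow> (\<forall>y z. {x, y} \<in> E \<and> {x, z} \<in> E \<and> y \<noteq> z \<longrightarrow>
     safe (c {x, y}) (seen E c x y) (c {x, z}) (seen E c x z))"

lemma vertex_okI:
  assumes "\<And>y. {x, y} \<in> E \<longleftrightarrow> y \<in> {y1, y2, y3}"
    and "safe3 (c {x, y1}) (seen E c x y1) (c {x, y2}) (seen E c x y2) (c {x, y3}) (seen E c x y3)"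
  shows "vertex_ok E c x"
proof -
  have "safe p S q T \<longleftrightarrow> safe q T p S" for p S q T unfolding safe_def by blast
  then show ?thesis using assms unfolding vertex_ok_def safe3_def by auto
qed

lemma seen_three:
  assumes "\<And>y. {x, y} \<in> E \<longleftrightarrow> y \<in> {y1, y2, y3}" "distinct [y1, y2, y3]"
  shows "seen E c y1 x = {c {x, y2}, c {x, y3}}" "seen E c y2 x = {c {x, y1}, c {x, y3}}"
    "seen E c y3 x = {c {x, y1}, c {x, y2}}"
  using assms unfolding seen_def by auto

text \<open>
  The middle vertex of a path with four edges, and any vertex of a cycle with four edges, has a
  pair of incident edges that is not safe if the path or cycle is bicoloured. A cycle is the
  closed walk \<open>p0 p1 p2 p3 p0\<close>, so both cases are about walks in which vertices at
  distance two differ.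
\<close>

lemma star_edge_coloringI:
  assumes star_ok: "\<And>x. x \<in> V \<Longrightarrow> vertex_ok E c x"
    and E: "\<And>e. e \<in> E \<Longrightarrow> e \<subseteq> V \<and> card e = 2"
  shows "star_edge_coloring V E c"
proof -
  have proper: "c {x, y} \<noteq> c {x, z}" if "{x, y} \<in> E" "{x, z} \<in> E" "y \<noteq> z" for x y z
    using star_ok[of x] E[OF that(1)] that unfolding vertex_ok_def safe_def by blast
  have star: "\<not> (c {p0, p1} = c {p2, p3} \<and> c {p1, p2} = c {p3, p4})"
    if p: "{p0, p1} \<in> E" "{p1, p2} \<in> E" "{p2, p3} \<in> E" "{p3, p4} \<in> E"
      "p0 \<noteq> p2" "p1 \<noteq> p3" "p2 \<noteq> p4" for p0 p1 p2 p3 p4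
  proof
    assume eq: "c {p0, p1} = c {p2, p3} \<and> c {p1, p2} = c {p3, p4}"
    have "{p2, p1} \<in> E" using p(2) by (simp add: insert_commute)
    moreover have "c {p2, p3} \<in> seen E c p2 p1"
      unfolding seen_def using eq p by (auto intro!: exI[of _ p0] simp: insert_commute)
    moreover have "c {p2, p1} \<in> seen E c p2 p3"
      unfolding seen_def using eq p by (auto intro!: exI[of _ p4] simp: insert_commute)
    moreover have "p2 \<in> V" using E[OF p(2)] by blast
    ultimately show False
      using star_ok[of p2] p(3,6) unfolding vertex_ok_def safe_def by blast
  qed
  have three: "3 \<le> card (c ` F)"
    if F: "{{p0, p1}, {p1, p2}, {p2, p3}, {p3, p4}} \<subseteq> F" "F \<subseteq> E" "finite F"
      "p0 \<noteq> p2" "p1 \<noteq> p3" "p2 \<noteq> p4" for F p0 p1 p2 p3 p4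
  proof -
    have e: "{p0, p1} \<in> E" "{p1, p2} \<in> E" "{p2, p3} \<in> E" "{p3, p4} \<in> E" using F by auto
    have d: "c {p0, p1} \<noteq> c {p1, p2}" "c {p1, p2} \<noteq> c {p2, p3}" "c {p2, p3} \<noteq> c {p3, p4}"
      using proper[of p1 p0 p2] proper[of p2 p1 p3] proper[of p3 p2 p4] e F(4-6)
      by (simp_all add: insert_commute)
    have "\<exists>S \<subseteq> c ` F. card S = 3"
    proof (cases "c {p0, p1} = c {p2, p3}")
      case True
      then have "c {p1, p2} \<noteq> c {p3, p4}" using star[OF e F(4-6)] by blast
      then show ?thesis using True d F(1)
        by (intro exI[of _ "{c {p1, p2}, c {p2, p3}, c {p3, p4}}"]) auto
    next
      case False
      then show ?thesis using d F(1)
        by (intro exI[of _ "{c {p0, p1}, c {p1, p2}, c {p2, p3}}"]) auto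
    qed
    then obtain S where "S \<subseteq> c ` F" "card S = 3" by blast
    then show ?thesis using card_mono[of "c ` F" S] F(3) by simp
  qed
  show ?thesis
    unfolding star_edge_coloring_def
  proof (intro conjI allI impI)
    show "proper_edge_coloring E c"
      unfolding proper_edge_coloring_def
    proof (intro ballI impI)
      fix e f assume ef: "e \<in> E" "f \<in> E" "e \<noteq> f \<and> e \<inter> f \<noteq> {}"
      then obtain x where x: "x \<in> e" "x \<in> f" by blast
      obtain y where "e = {x, y}" using E[OF ef(1)] x(1) by (auto simp: card_2_iff)
      moreover obtain z where "f = {x, z}" using E[OF ef(2)] x(2) by (auto simp: card_2_iff)
      ultimately show "c e \<noteq> c f" using proper[of x y z] ef by auto
    qed
  next
    fix p assume p: "graph_path V E p \<and> length p = 5"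
    then obtain p0 p1 p2 p3 p4 where pp: "p = [p0, p1, p2, p3, p4]"
      by (auto simp: numeral_eq_Suc length_Suc_conv)
    have e: "path_edges p = {{p0, p1}, {p1, p2}, {p2, p3}, {p3, p4}}"
      unfolding pp by (simp add: path_edges_Cons)
    show "3 \<le> card (c ` path_edges p)"
      by (rule three[of p0 p1 p2 p3 p4]) (use p e pp in \<open>auto simp: graph_path_def\<close>)
  next
    fix p assume p: "graph_cycle V E p \<and> length p = 4"
    then obtain p0 p1 p2 p3 where pp: "p = [p0, p1, p2, p3]"
      by (auto simp: numeral_eq_Suc length_Suc_conv)
    have e: "cycle_edges p = {{p0, p1}, {p1, p2}, {p2, p3}, {p3, p0}}"
      unfolding pp by (simp add: cycle_edges_Cons path_edges_Cons)
    show "3 \<le> card (c ` cycle_edges p)"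
      by (rule three[of p0 p1 p2 p3 p0]) (use p e pp in \<open>auto simp: graph_cycle_def\<close>)
  qed
qed

lemma star_chromatic_index_le:
  assumes "star_edge_coloring V E (c :: 'a set \<Rightarrow> nat)" "c ` E \<subseteq> {..<k}"
  shows "star_chromatic_index V E \<le> k"
  unfolding star_chromatic_index_def using assms by (intro Least_le) blast

section \<open>Colour patterns on plane binary trees\<close>

datatype (verts: 'a) btree = Leaf 'a | Node "'a btree" 'a "'a btree"

primrec apex :: "'a btree \<Rightarrow> 'a" where
  "apex (Leaf x) = x" | "apex (Node l v r) = v"
primrec leftmost :: "'a btree \<Rightarrow> 'a" where
  "leftmost (Leaf x) = x" | "leftmost (Node l v r) = leftmost l"
primrec rightmost :: "'a btree \<Rightarrow> 'a" where
  "rightmost (Leaf x) = x" | "rightmost (Node l v r) = rightmost r"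

text \<open>
  The colours in a piece of the graph. An inner vertex contributes the colours
  \<open>\<beta>\<close> and \<open>\<gamma>\<close> of the edges to its children and the colour
  \<open>m\<close> of the cycle edge between the leaves of its left and of its right subtree. The
  three edges that lead out of the piece are not part of it; they have colours \<open>P\<close>
  (above the apex), \<open>L\<close> and \<open>R\<close> (at the leftmost and the rightmost
  leaf).
\<close>

datatype pattern = PLeaf | PNode nat pattern nat pattern nat

primrec fits :: "'a btree \<Rightarrow> pattern \<Rightarrow> bool" where
  "fits (Leaf x) ct \<longleftrightarrow> ct = PLeaf"
| "fits (Node l v r) ct \<longleftrightarrow> (\<exists>\<beta> cl m cr \<gamma>. ct = PNode \<beta> cl m cr \<gamma> \<and> fits l cl \<and> fits r cr)"

primrec colours :: "pattern \<Rightarrow> nat set" where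
  "colours PLeaf = {}"
| "colours (PNode \<beta> cl m cr \<gamma>) = {\<beta>, m, \<gamma>} \<union> colours cl \<union> colours cr"

text \<open>
  Across each of the three outer edges a piece shows two colours. For a leaf, which is the common
  end of these edges, they are the colours of the other two.
\<close>

primrec seen_top :: "pattern \<Rightarrow> nat \<Rightarrow> nat \<Rightarrow> nat set" where
  "seen_top PLeaf L R = {L, R}"
| "seen_top (PNode \<beta> cl m cr \<gamma>) L R = {\<beta>, \<gamma>}"
primrec seen_left :: "pattern \<Rightarrow> nat \<Rightarrow> nat \<Rightarrow> nat set" where
  "seen_left PLeaf P R = {P, R}"
| "seen_left (PNode \<beta> cl m cr \<gamma>) P R = seen_left cl \<beta> m"
primrec seen_right :: "pattern \<Rightarrow> nat \<Rightarrow> nat \<Rightarrow> nat set" where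
  "seen_right PLeaf P L = {P, L}"
| "seen_right (PNode \<beta> cl m cr \<gamma>) P L = seen_right cr \<gamma> m"

text \<open>
  All vertices of the piece are safe if the rest of the graph shows \<open>sP\<close>,
  \<open>sL\<close> and \<open>sR\<close> across the outer edges. The edges to the children and
  the edge \<open>m\<close> are outer edges of the smaller pieces, for which the other child is a
  part of the rest.
\<close>

primrec star_ok :: "pattern \<Rightarrow> nat \<Rightarrow> nat set \<Rightarrow> nat \<Rightarrow> nat set \<Rightarrow> nat \<Rightarrow> nat set \<Rightarrow> bool" where
  "star_ok PLeaf P sP L sL R sR \<longleftrightarrow> safe3 P sP L sL R sR"
| "star_ok (PNode \<beta> cl m cr \<gamma>) P sP L sL R sR \<longleftrightarrow>
     safe3 P sP \<beta> (seen_top cl L m) \<gamma> (seen_top cr m R) \<and>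
     star_ok cl \<beta> {P, \<gamma>} L sL m (seen_left cr \<gamma> R) \<and>
     star_ok cr \<gamma> {P, \<beta>} m (seen_right cl \<beta> L) R sR"

lemma safe_mono: "safe p S q T \<Longrightarrow> S' \<subseteq> S \<Longrightarrow> T' \<subseteq> T \<Longrightarrow> safe p S' q T'"
  unfolding safe_def by blast

lemma star_ok_mono:
  "star_ok ct P sP L sL R sR \<Longrightarrow> sP' \<subseteq> sP \<Longrightarrow> sL' \<subseteq> sL \<Longrightarrow> sR' \<subseteq> sR \<Longrightarrow> star_ok ct P sP' L sL' R sR'"
proof (induction ct arbitrary: P sP sP' L sL sL' R sR sR')
  case PLeaf
  then show ?case by (auto simp: safe3_def intro: safe_mono)
next
  case (PNode \<beta> cl m cr \<gamma>)
  have "star_ok cl \<beta> {P, \<gamma>} L sL' m (seen_left cr \<gamma> R)" "star_ok cr \<gamma> {P, \<beta>} m (seen_right cl \<beta> L) R sR'"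
    using PNode.prems by (auto intro: PNode.IH)
  moreover have "safe3 P sP' \<beta> (seen_top cl L m) \<gamma> (seen_top cr m R)"
    using PNode.prems by (auto simp: safe3_def intro: safe_mono)
  ultimately show ?case by simp
qed

section \<open>From patterns to edge colourings\<close>

text \<open>
  The edge colouring \<open>c\<close> has the colours of the pattern on \<open>t\<close>, where
  the outer edges lead from the apex to \<open>u\<close>, from the leftmost leaf to
  \<open>a\<close> and from the rightmost leaf to \<open>b\<close>.
\<close>

primrec realizes :: "('a set \<Rightarrow> nat) \<Rightarrow> 'a btree \<Rightarrow> pattern \<Rightarrow> 'a \<Rightarrow> nat \<Rightarrow> 'a \<Rightarrow> nat \<Rightarrow> 'a \<Rightarrow> nat \<Rightarrow> bool" where
  "realizes c (Leaf x) ct u P a L b R \<longleftrightarrow> ct = PLeaf \<and> c {u, x} = P \<and> c {a, x} = L \<and> c {x, b} = R"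
| "realizes c (Node l v r) ct u P a L b R \<longleftrightarrow> c {u, v} = P \<and>
     (\<exists>\<beta> cl m cr \<gamma>. ct = PNode \<beta> cl m cr \<gamma> \<and>
       realizes c l cl v \<beta> a L (leftmost r) m \<and> realizes c r cr v \<gamma> (rightmost l) m b R)"

text \<open>
  The vertices of \<open>t\<close> have, in the graph \<open>E\<close>, the three neighbours that
  the plane tree \<open>t\<close> and the outer vertices \<open>u\<close>, \<open>a\<close> and
  \<open>b\<close> suggest. The outer vertices of a tree that is not a leaf may coincide.
\<close>

primrec attached :: "'a set set \<Rightarrow> 'a btree \<Rightarrow> 'a \<Rightarrow> 'a \<Rightarrow> 'a \<Rightarrow> bool" where
  "attached E (Leaf x) u a b \<longleftrightarrow> (\<forall>y. {x, y} \<in> E \<longleftrightarrow> y \<in> {u, a, b}) \<and> distinct [u, a, b]"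
| "attached E (Node l v r) u a b \<longleftrightarrow>
     (\<forall>y. {v, y} \<in> E \<longleftrightarrow> y \<in> {u, apex l, apex r}) \<and> distinct [u, apex l, apex r] \<and>
     attached E l v a (leftmost r) \<and> attached E r v (rightmost l) b"

lemma top_edge: "realizes c t ct u P a L b R \<Longrightarrow> c {u, apex t} = P"
  by (cases t) auto
lemma left_edge: "realizes c t ct u P a L b R \<Longrightarrow> c {a, leftmost t} = L"
  by (induction t arbitrary: ct u P b R) auto
lemma right_edge: "realizes c t ct u P a L b R \<Longrightarrow> c {rightmost t, b} = R"
  by (induction t arbitrary: ct u P a L) auto

lemma seen_top_eq:
  assumes "realizes c t ct u P a L b R" "attached E t u a b"
  shows "seen E c u (apex t) = seen_top ct L R"
proof (cases t)
  case (Leaf x)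
  then have "seen E c u x = {c {x, a}, c {x, b}}" using assms by (intro seen_three) auto
  then show ?thesis using Leaf assms by (auto simp: insert_commute)
next
  case (Node l v r)
  then have "seen E c u v = {c {v, apex l}, c {v, apex r}}" using assms by (intro seen_three) auto
  then show ?thesis using Node assms by (auto dest!: top_edge)
qed

lemma seen_left_eq:
  assumes "realizes c t ct u P a L b R" "attached E t u a b"
  shows "seen E c a (leftmost t) = seen_left ct P R"
  using assms
proof (induction t arbitrary: ct u P b R)
  case (Leaf x)
  then have "seen E c a x = {c {x, u}, c {x, b}}" by (intro seen_three) auto
  then show ?case using Leaf by (auto simp: insert_commute)
qed auto

lemma seen_right_eq:
  assumes "realizes c t ct u P a L b R" "attached E t u a b"
  shows "seen E c b (rightmost t) = seen_right ct P L"
  using assms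
proof (induction t arbitrary: ct u P a L)
  case (Leaf x)
  then have "seen E c b x = {c {x, u}, c {x, a}}" by (intro seen_three) auto
  then show ?case using Leaf by (auto simp: insert_commute)
qed auto

text \<open>
  The recursion of \<open>star_ok\<close> follows the graph: what the parent and the neighbouring
  leaf show to a subtree is computed there from the outer edges and the other child.
\<close>

lemma star_ok_imp_vertex_ok:
  assumes "realizes c t ct u P a L b R" "attached E t u a b"
    and "star_ok ct P (seen E c (apex t) u) L (seen E c (leftmost t) a) R (seen E c (rightmost t) b)"
    and "x \<in> verts t"
  shows "vertex_ok E c x"
  using assms
proof (induction t arbitrary: ct u P a L b R)
  case (Leaf y)
  then show ?case
    by (intro vertex_okI[of x E u a b]) (auto simp: insert_commute)
next
  case (Node l v r)
  obtain \<beta> cl m cr \<gamma> where ct: "ct = PNode \<beta> cl m cr \<gamma>"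
    and rl: "realizes c l cl v \<beta> a L (leftmost r) m" and rr: "realizes c r cr v \<gamma> (rightmost l) m b R"
    and P: "c {u, v} = P"
    using Node.prems by auto
  have al: "attached E l v a (leftmost r)" and ar: "attached E r v (rightmost l) b"
    and nb: "\<And>y. {v, y} \<in> E \<longleftrightarrow> y \<in> {u, apex l, apex r}" and d: "distinct [u, apex l, apex r]"
    using Node.prems by auto
  have star_ok: "safe3 P (seen E c v u) \<beta> (seen_top cl L m) \<gamma> (seen_top cr m R)"
    "star_ok cl \<beta> {P, \<gamma>} L (seen E c (leftmost l) a) m (seen_left cr \<gamma> R)"
    "star_ok cr \<gamma> {P, \<beta>} m (seen_right cl \<beta> L) R (seen E c (rightmost r) b)"
    using Node.prems(3) unfolding ct by auto
  note tops = top_edge[OF rl] top_edge[OF rr]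
  have sv: "seen E c (apex l) v = {P, \<gamma>}" "seen E c (apex r) v = {P, \<beta>}"
    using seen_three(2,3)[OF nb d, of c] tops P by (auto simp: insert_commute)
  show ?case
  proof (cases "x = v")
    case True
    have "vertex_ok E c v"
      by (rule vertex_okI[OF nb])
        (use star_ok(1) tops P in \<open>simp add: insert_commute seen_top_eq[OF rl al] seen_top_eq[OF rr ar]\<close>)
    then show ?thesis using True by simp
  next
    case False
    then consider "x \<in> verts l" | "x \<in> verts r" using Node.prems(4) by auto
    then show ?thesis
    proof cases
      case 1
      then show ?thesis
        using Node.IH(1)[OF rl al] star_ok(2) sv seen_left_eq[OF rr ar] by simp
    next
      case 2
      then show ?thesis
        using Node.IH(2)[OF rr ar] star_ok(3) sv seen_right_eq[OF rl al] by simp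
    qed
  qed
qed

lemma realizes_colours:
  assumes "realizes c t ct u P a L b R" "attached E t u a b" "x \<in> verts t" "{x, y} \<in> E"
  shows "c {x, y} \<in> {P, L, R} \<union> colours ct"
  using assms
proof (induction t arbitrary: ct u P a L b R)
  case (Leaf z)
  then show ?case by (auto simp: insert_commute)
next
  case (Node l v r)
  obtain \<beta> cl m cr \<gamma> where ct: "ct = PNode \<beta> cl m cr \<gamma>"
    and rl: "realizes c l cl v \<beta> a L (leftmost r) m" and rr: "realizes c r cr v \<gamma> (rightmost l) m b R"
    and P: "c {u, v} = P"
    using Node.prems(1) by auto
  consider "x = v" | "x \<in> verts l" | "x \<in> verts r" using Node.prems(3) by auto
  then show ?case
  proof cases
    case 1
    then have "y \<in> {u, apex l, apex r}" using Node.prems(2,4) by simp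
    then show ?thesis using 1 P ct top_edge[OF rl] top_edge[OF rr] by (auto simp: insert_commute)
  next
    case 2
    then show ?thesis using Node.IH(1)[OF rl _ 2 Node.prems(4)] Node.prems(2) ct by auto
  next
    case 3
    then show ?thesis using Node.IH(2)[OF rr _ 3 Node.prems(4)] Node.prems(2) ct by auto
  qed
qed

lemma realizes_cong:
  assumes "\<And>e. e \<inter> verts t \<noteq> {} \<Longrightarrow> c e = c' e" "realizes c t ct u P a L b R"
  shows "realizes c' t ct u P a L b R"
  using assms
proof (induction t arbitrary: ct u P a L b R)
  case (Leaf x)
  then show ?case by auto
next
  case (Node l v r)
  have "c {u, v} = c' {u, v}" by (rule Node.prems) auto
  moreover have "realizes c' l ctl u' P' a' L' b' R'" if "realizes c l ctl u' P' a' L' b' R'" for ctl u' P' a' L' b' R'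
    using that by (intro Node.IH(1)[OF Node.prems(1)]) auto
  moreover have "realizes c' r ctl u' P' a' L' b' R'" if "realizes c r ctl u' P' a' L' b' R'" for ctl u' P' a' L' b' R'
    using that by (intro Node.IH(2)[OF Node.prems(1)]) auto
  ultimately show ?case using Node.prems(2) by auto
qed

primrec distinct_tree :: "'a btree \<Rightarrow> bool" where
  "distinct_tree (Leaf x) \<longleftrightarrow> True"
| "distinct_tree (Node l v r) \<longleftrightarrow> distinct_tree l \<and> distinct_tree r \<and>
     v \<notin> verts l \<union> verts r \<and> verts l \<inter> verts r = {}"

lemma in_verts [simp]: "apex t \<in> verts t" "leftmost t \<in> verts t" "rightmost t \<in> verts t"
  by (induction t) auto

text \<open>
  The colours of the outer edges can be given in advance, by a colouring \<open>c\<close> that is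
  changed only on edges inside \<open>t\<close>. In this form the claim passes to the children,
  whose outer edges are shared.
\<close>

lemma ex_realizes:
  assumes "distinct_tree t" "fits t ct" "u \<notin> verts t" "a \<notin> verts t" "b \<notin> verts t"
    and "c {u, apex t} = P" "c {a, leftmost t} = L" "c {rightmost t, b} = R"
  shows "\<exists>c'. (\<forall>e. \<not> e \<subseteq> verts t \<longrightarrow> c' e = c e) \<and> realizes c' t ct u P a L b R"
  using assms
proof (induction t arbitrary: ct c u P a L b R)
  case (Leaf x)
  then show ?case by (intro exI[of _ c]) auto
next
  case (Node l v r)
  obtain \<beta> cl m cr \<gamma> where ct: "ct = PNode \<beta> cl m cr \<gamma>" and f: "fits l cl" "fits r cr"
    using Node.prems by auto
  have disj: "verts l \<inter> verts r = {}" "v \<notin> verts l" "v \<notin> verts r" "distinct_tree l" "distinct_tree r"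
    and out: "u \<noteq> v" "a \<noteq> v" "b \<noteq> v" "u \<notin> verts l" "u \<notin> verts r" "a \<notin> verts l" "a \<notin> verts r" "b \<notin> verts l" "b \<notin> verts r"
    using Node.prems by auto
  have lr: "x \<noteq> y" if "x \<in> verts l" "y \<in> verts r" for x y using that disj by auto
  let ?c1 = "c({v, apex l} := \<beta>, {v, apex r} := \<gamma>, {rightmost l, leftmost r} := m)"
  have ne: "apex l \<noteq> v" "apex r \<noteq> v" "rightmost l \<noteq> v" "leftmost r \<noteq> v" "leftmost l \<noteq> v" "rightmost r \<noteq> v"
    using disj in_verts by metis+
  have ne2: "leftmost l \<noteq> leftmost r" "rightmost l \<noteq> rightmost r" "apex l \<noteq> apex r" "rightmost l \<noteq> leftmost r"
      "a \<noteq> leftmost r" "a \<noteq> rightmost l" "b \<noteq> rightmost l" "b \<noteq> leftmost r"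
     "u \<noteq> apex l" "u \<noteq> apex r" "leftmost r \<notin> verts l"
    using lr out in_verts by metis+
  \<comment> \<open>No outer edge of a subtree is contained in it, so each call keeps the colours given to
    the edges around the other subtree.\<close>
  obtain c2 where c2: "\<And>e. \<not> e \<subseteq> verts l \<Longrightarrow> c2 e = ?c1 e" "realizes c2 l cl v \<beta> a L (leftmost r) m"
    using Node.IH(1)[of cl v a "leftmost r" ?c1 \<beta> L m] f disj out ne ne2 Node.prems lr
    by (fastforce simp: doubleton_eq_iff)
  have c2r: "c2 {v, apex r} = \<gamma>" "c2 {rightmost l, leftmost r} = m" "c2 {rightmost r, b} = R"
    using c2(1)[of "{v, apex r}"] c2(1)[of "{rightmost l, leftmost r}"] c2(1)[of "{rightmost r, b}"]
      disj out ne ne2 Node.prems lr by (auto simp: doubleton_eq_iff)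
  obtain c3 where c3: "\<And>e. \<not> e \<subseteq> verts r \<Longrightarrow> c3 e = c2 e" "realizes c3 r cr v \<gamma> (rightmost l) m b R"
    using Node.IH(2)[of cr v "rightmost l" b c2 \<gamma> m R] f disj out c2r lr in_verts by blast
  have "realizes c3 l cl v \<beta> a L (leftmost r) m"
  proof (rule realizes_cong[OF _ c2(2)])
    fix e assume "e \<inter> verts l \<noteq> {}"
    then have "\<not> e \<subseteq> verts r" using disj(1) by blast
    then show "c2 e = c3 e" using c3(1) by simp
  qed
  moreover have c3e: "c3 e = c e" if "\<not> e \<subseteq> verts (Node l v r)" for e
  proof -
    have "\<not> e \<subseteq> verts r" "\<not> e \<subseteq> verts l" "e \<noteq> {v, apex l}" "e \<noteq> {v, apex r}" "e \<noteq> {rightmost l, leftmost r}"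
      using that by auto
    then show ?thesis using c3(1) c2(1) by simp
  qed
  moreover have "c3 {u, v} = P" using c3e[of "{u, v}"] out Node.prems by auto
  ultimately show ?case using ct c3(2) by (intro exI[of _ c3]) auto
qed

section \<open>Demands that every tree meets\<close>

text \<open>
  A demand on a piece. Its outer edges have colours \<open>P\<close>, \<open>L\<close> and
  \<open>R\<close>, and the rest of the graph shows at most \<open>sP\<close> above and
  \<open>sR\<close> on the right. The piece must show no colour of \<open>N\<close> above and
  exactly the set \<open>A\<close> on the left, where it has to be safe whatever is shown to it.
  It promises nothing about what it shows on the right.

  The asymmetry makes two neighbouring pieces independent of each other: across the cycle edge
  between them the right piece shows a known set to the left one, and is itself prepared for
  everything.
\<close>

definition colourable :: "'a btree \<Rightarrow> nat \<Rightarrow> nat set \<Rightarrow> nat set \<Rightarrow> nat \<Rightarrow> nat set \<Rightarrow> nat \<Rightarrow> nat set \<Rightarrow> bool" where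
  "colourable t P sP N L A R sR \<longleftrightarrow> (\<exists>ct. fits t ct \<and> colours ct \<subseteq> {..<6} \<and>
     star_ok ct P sP L UNIV R sR \<and> seen_top ct L R \<inter> N = {} \<and> seen_left ct P R = A)"

lemma colourable_weaken:
  assumes "colourable t P sP' N' L A' R sR'" "sP \<subseteq> sP'" "N \<subseteq> N'" "A = A'" "sR \<subseteq> sR'"
  shows "colourable t P sP N L A R sR"
  using assms unfolding colourable_def by (blast intro: star_ok_mono)

lemma colourable_Leaf:
  assumes "distinct [P, L, R]" "A = {P, R}" "{L, R} \<inter> N = {}"
    "L \<notin> sP" "L \<notin> sR" "R \<notin> sP \<or> P \<notin> sR"
  shows "colourable (Leaf x) P sP N L A R sR"
  using assms by (auto simp: colourable_def safe3_def safe_def)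

text \<open>
  Splitting a demand. The set \<open>B\<close> is what the right piece shows to the left one
  across \<open>m\<close>. At the apex \<open>v\<close>, safety of the edges to the children
  against each other and against the edge above is obtained by asking the pieces not to show the
  colours in \<open>M\<close> and \<open>N\<close>.
\<close>

lemma colourable_Node:
  assumes l: "colourable l \<beta> {P, \<gamma>} M L A m B"
    and r: "colourable r \<gamma> {P, \<beta>} N m B R sR"
    and "distinct [P, \<beta>, \<gamma>]" "{\<beta>, m, \<gamma>} \<subseteq> {..<6}"
    and "\<beta> \<notin> sP \<or> P \<in> M" "\<gamma> \<notin> sP \<or> P \<in> N" "\<gamma> \<in> M \<or> \<beta> \<in> N"
    and "{\<beta>, \<gamma>} \<inter> K = {}"
  shows "colourable (Node l v r) P sP K L A R sR"
proof -
  obtain cl where cl: "fits l cl" "colours cl \<subseteq> {..<6}" "star_ok cl \<beta> {P, \<gamma>} L UNIV m B"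
    "seen_top cl L m \<inter> M = {}" "seen_left cl \<beta> m = A"
    using l unfolding colourable_def by blast
  obtain cr where cr: "fits r cr" "colours cr \<subseteq> {..<6}" "star_ok cr \<gamma> {P, \<beta>} m UNIV R sR"
    "seen_top cr m R \<inter> N = {}" "seen_left cr \<gamma> R = B"
    using r unfolding colourable_def by blast
  have "star_ok cr \<gamma> {P, \<beta>} m (seen_right cl \<beta> L) R sR"
    by (rule star_ok_mono[OF cr(3)]) auto
  moreover have "safe3 P sP \<beta> (seen_top cl L m) \<gamma> (seen_top cr m R)"
    using assms(3-) cl(4) cr(4) unfolding safe3_def safe_def by auto
  ultimately have "star_ok (PNode \<beta> cl m cr \<gamma>) P sP L UNIV R sR"
    using cl cr by simp
  then show ?thesis
    unfolding colourable_def using cl cr assms(4,8) by (intro exI[of _ "PNode \<beta> cl m cr \<gamma>"]) auto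
qed

text \<open>
  If both children are leaves, the right one cannot always be prepared for everything that is
  shown across \<open>m\<close>, but the left one is known completely.
\<close>

lemma colourable_cherry:
  assumes "star_ok (PNode \<beta> PLeaf m PLeaf \<gamma>) P sP L UNIV R sR" "{\<beta>, m, \<gamma>} \<subseteq> {..<6}"
    and "{\<beta>, \<gamma>} \<inter> N = {}" "A = {\<beta>, m}"
  shows "colourable (Node (Leaf x) v (Leaf y)) P sP N L A R sR"
  unfolding colourable_def using assms by (intro exI[of _ "PNode \<beta> PLeaf m PLeaf \<gamma>"]) auto

text \<open>
  Six colours, of which \<open>p\<close>, \<open>l\<close> and \<open>r\<close> will be those of
  the outer edges. Stating the demands for every palette makes them invariant under renaming the
  colours.
\<close>

definition palette :: "nat \<Rightarrow> nat \<Rightarrow> nat \<Rightarrow> nat \<Rightarrow> nat \<Rightarrow> nat \<Rightarrow> bool" where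
  "palette p l r a b c \<longleftrightarrow> distinct [p, l, r, a, b, c] \<and> {p, l, r, a, b, c} \<subseteq> {..<6}"

lemma paletteD:
  assumes "palette p l r a b c"
  shows "p \<noteq> l" "p \<noteq> r" "p \<noteq> a" "p \<noteq> b" "p \<noteq> c" "l \<noteq> r" "l \<noteq> a" "l \<noteq> b" "l \<noteq> c"
    "r \<noteq> a" "r \<noteq> b" "r \<noteq> c" "a \<noteq> b" "a \<noteq> c" "b \<noteq> c"
    "l \<noteq> p" "r \<noteq> p" "a \<noteq> p" "b \<noteq> p" "c \<noteq> p" "r \<noteq> l" "a \<noteq> l" "b \<noteq> l" "c \<noteq> l"
    "a \<noteq> r" "b \<noteq> r" "c \<noteq> r" "b \<noteq> a" "c \<noteq> a" "c \<noteq> b"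
    "p < 6" "l < 6" "r < 6" "a < 6" "b < 6" "c < 6"
  using assms unfolding palette_def by auto

text \<open>
  A set of demands that is closed under splitting. It is one of many such sets, chosen to be
  small; the only demand with a purpose of its own is \<open>d1\<close>, which is used at the
  root. The empty sets mean that nothing is asked about the colours shown above.
\<close>

inductive demand :: "nat \<Rightarrow> nat set \<Rightarrow> nat set \<Rightarrow> nat \<Rightarrow> nat set \<Rightarrow> nat \<Rightarrow> nat set \<Rightarrow> bool" where
  d1: "palette p l r a b c \<Longrightarrow> demand p {l, r} {l, r} l {p, a} r {p, l}"
| d2: "palette p l r a b c \<Longrightarrow> demand p {r, a} {r, a} l {a, b} r {p, c}"
| d3: "palette p l r a b c \<Longrightarrow> demand p {l, a} {} l {p, b} r {l, c}"
| d4: "palette p l r a b c \<Longrightarrow> demand p {a, b} {} l {a, b} r {p, a}"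
| d5: "palette p l r a b c \<Longrightarrow> demand p {a, b} {} l {a, c} r {a, c}"
| d6: "palette p l r a b c \<Longrightarrow> demand p {a, b} {b} l {a, b} r {l, a}"
| d7: "palette p l r a b c \<Longrightarrow> demand p {l, a} {} l {r, b} r {l, c}"
| d8: "palette p l r a b c \<Longrightarrow> demand p {r, a} {a} l {a, b} r {a, b}"
| d9: "palette p l r a b c \<Longrightarrow> demand p {a, b} {} l {a, b} r {a, c}"
| d10: "palette p l r a b c \<Longrightarrow> demand p {r, a} {r, a} l {p, b} r {p, l}"
| d11: "palette p l r a b c \<Longrightarrow> demand p {l, r} {} l {r, a} r {p, b}"
| d12: "palette p l r a b c \<Longrightarrow> demand p {l, a} {a} l {a, b} r {p, l}"
| d13: "palette p l r a b c \<Longrightarrow> demand p {l, a} {} l {r, b} r {p, c}"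

definition flexible :: "'a btree \<Rightarrow> bool" where
  "flexible t \<longleftrightarrow> (\<forall>P sP N L A R sR. demand P sP N L A R sR \<longrightarrow> colourable t P sP N L A R sR)"

lemma colourable_flexible:
  assumes "flexible t" "demand P sP' N' L A' R sR'"
    and "sP \<subseteq> sP'" "N \<subseteq> N'" "A = A'" "sR \<subseteq> sR'"
  shows "colourable t P sP N L A R sR"
  using assms unfolding flexible_def by (blast intro: colourable_weaken)

lemma child_cases:
  fixes t1 t2 :: "'a btree"
  assumes "((\<exists>x. t1 = Leaf x) \<or> flexible t1) \<and> ((\<exists>y. t2 = Leaf y) \<or> flexible t2)"
  obtains (LL) x y where "t1 = Leaf x" "t2 = Leaf y"
    | (LF) x where "t1 = Leaf x" "flexible t2"
    | (FL) y where "t2 = Leaf y" "flexible t1"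
    | (FF) "flexible t1" "flexible t2"
  using assms by blast

text \<open>
  The cases distinguish which of the two children are leaves. The arguments of
  \<open>colourable_Node\<close> are, in this order, the colours \<open>\<beta>\<close> and
  \<open>\<gamma>\<close> of the edges to the children, the set \<open>M\<close> that the left
  child must not show, the colour \<open>m\<close> of the cycle edge between the children, the set
  \<open>B\<close> shown across it from the right, and the set \<open>N\<close> that the right
  child must not show. For a child that is not a leaf the demand is named together with its
  palette. For two leaves it suffices to name \<open>\<beta>\<close>, \<open>m\<close> and
  \<open>\<gamma>\<close>. What remains are comparisons of small sets of colours.
\<close>

lemma demand_split:
  fixes t1 t2 :: "'a btree"
  assumes "demand P sP N L A R sR"
    and children: "((\<exists>x. t1 = Leaf x) \<or> flexible t1) \<and> ((\<exists>y. t2 = Leaf y) \<or> flexible t2)"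
  shows "colourable (Node t1 v t2) P sP N L A R sR"
  using assms(1)
proof (induction rule: demand.induct)
  case (d1 p l r a b c)
  note [simp] = paletteD[OF d1] palette_def insert_commute
  show ?case using children
  proof (cases rule: child_cases)
    case LL
    show ?thesis unfolding LL
      by (rule colourable_cherry[of a p b]) (simp_all add: safe3_def safe_def)
  next
    case LF
    show ?thesis unfolding LF(1)
      by (rule colourable_Node[of _ a _ b "{b}" _ _ p "{r, c}" _ "{}"],
        rule colourable_Leaf, simp_all,
        rule colourable_flexible[OF LF(2) d7[of b p r a c l]], simp_all)
  next
    case FL
    show ?thesis unfolding FL(1)
      by (rule colourable_Node[of _ b _ a "{}" _ _ c "{r, a}" _ "{b}"],
        rule colourable_flexible[OF FL(2) d9[of b l c a p r]], simp_all,
        rule colourable_Leaf, simp_all)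
  next
    case FF
    show ?thesis
      by (rule colourable_Node[of _ b _ a "{a}" _ _ c "{p, l}" _ "{}"],
        rule colourable_flexible[OF FF(1) d6[of b l c p a r]], simp_all,
        rule colourable_flexible[OF FF(2) d5[of a c r p b l]], simp_all)
  qed
next
  case (d2 p l r a b c)
  note [simp] = paletteD[OF d2] palette_def insert_commute
  show ?case using children
  proof (cases rule: child_cases)
    case LL
    show ?thesis unfolding LL
      by (rule colourable_cherry[of b a c]) (simp_all add: safe3_def safe_def)
  next
    case LF
    show ?thesis unfolding LF(1)
      by (rule colourable_Node[of _ b _ c "{c}" _ _ a "{p, b}" _ "{}"],
        rule colourable_Leaf, simp_all,
        rule colourable_flexible[OF LF(2) d4[of c a r p b l]], simp_all)
  next
    case FL
    show ?thesis unfolding FL(1)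
      by (rule colourable_Node[of _ c _ l "{}" _ _ a "{l, r}" _ "{c}"],
        rule colourable_flexible[OF FL(2) d7[of c l a p b r]], simp_all,
        rule colourable_Leaf, simp_all)
  next
    case FF
    show ?thesis
      by (rule colourable_Node[of _ b _ c "{}" _ _ p "{l, b}" _ "{b}"],
        rule colourable_flexible[OF FF(1) d10[of b l p c a r]], simp_all,
        rule colourable_flexible[OF FF(2) d12[of c p r b l a]], simp_all)
  qed
next
  case (d3 p l r a b c)
  note [simp] = paletteD[OF d3] palette_def insert_commute
  show ?case using children
  proof (cases rule: child_cases)
    case LL
    show ?thesis unfolding LL
      by (rule colourable_cherry[of b p c]) (simp_all add: safe3_def safe_def)
  next
    case LF
    show ?thesis unfolding LF(1)
      by (rule colourable_Node[of _ b _ c "{c}" _ _ p "{r, a}" _ "{}"],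
        rule colourable_Leaf, simp_all,
        rule colourable_flexible[OF LF(2) d13[of c p r b a l]], simp_all)
  next
    case FL
    show ?thesis unfolding FL(1)
      by (rule colourable_Node[of _ c _ b "{}" _ _ a "{r, b}" _ "{c}"],
        rule colourable_flexible[OF FL(2) d9[of c l a b p r]], simp_all,
        rule colourable_Leaf, simp_all)
  next
    case FF
    show ?thesis
      by (rule colourable_Node[of _ r _ c "{}" _ _ a "{p, b}" _ "{r}"],
        rule colourable_flexible[OF FF(1) d5[of r l a p c b]], simp_all,
        rule colourable_flexible[OF FF(2) d2[of c a r p b l]], simp_all)
  qed
next
  case (d4 p l r a b c)
  note [simp] = paletteD[OF d4] palette_def insert_commute
  show ?case using children
  proof (cases rule: child_cases)
    case LL
    show ?thesis unfolding LL
      by (rule colourable_cherry[of a b c]) (simp_all add: safe3_def safe_def)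
  next
    case LF
    show ?thesis unfolding LF(1)
      by (rule colourable_Node[of _ b _ c "{p}" _ _ a "{p, b}" _ "{b}"],
        rule colourable_Leaf, simp_all,
        rule colourable_flexible[OF LF(2) d6[of c a r p b l]], simp_all)
  next
    case FL
    show ?thesis unfolding FL(1)
      by (rule colourable_Node[of _ c _ l "{}" _ _ b "{l, r}" _ "{c}"],
        rule colourable_flexible[OF FL(2) d7[of c l b p a r]], simp_all,
        rule colourable_Leaf, simp_all)
  next
    case FF
    show ?thesis
      by (rule colourable_Node[of _ r _ a "{}" _ _ p "{a, b}" _ "{p, r}"],
        rule colourable_flexible[OF FF(1) d8[of r l p a b c]], simp_all,
        rule colourable_flexible[OF FF(2) d1[of a p r b l c]], simp_all)
  qed
next
  case (d5 p l r a b c)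
  note [simp] = paletteD[OF d5] palette_def insert_commute
  show ?case using children
  proof (cases rule: child_cases)
    case LL
    show ?thesis unfolding LL
      by (rule colourable_cherry[of a c b]) (simp_all add: safe3_def safe_def)
  next
    case LF
    show ?thesis unfolding LF(1)
      by (rule colourable_Node[of _ a _ b "{p, b}" _ _ c "{p, a}" _ "{p}"],
        rule colourable_Leaf, simp_all,
        rule colourable_flexible[OF LF(2) d6[of b c r a p l]], simp_all)
  next
    case FL
    show ?thesis unfolding FL(1)
      by (rule colourable_Node[of _ c _ l "{}" _ _ b "{l, r}" _ "{c}"],
        rule colourable_flexible[OF FL(2) d3[of c l b p a r]], simp_all,
        rule colourable_Leaf, simp_all)
  next
    case FF
    show ?thesis
      by (rule colourable_Node[of _ r _ c "{c}" _ _ p "{r, b}" _ "{}"],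
        rule colourable_flexible[OF FF(1) d2[of r l p c a b]], simp_all,
        rule colourable_flexible[OF FF(2) d11[of c p r b a l]], simp_all)
  qed
next
  case (d6 p l r a b c)
  note [simp] = paletteD[OF d6] palette_def insert_commute
  show ?case using children
  proof (cases rule: child_cases)
    case LL
    show ?thesis unfolding LL
      by (rule colourable_cherry[of a b c]) (simp_all add: safe3_def safe_def)
  next
    case LF
    show ?thesis unfolding LF(1)
      by (rule colourable_Node[of _ a _ c "{p, c}" _ _ b "{p, a}" _ "{}"],
        rule colourable_Leaf, simp_all,
        rule colourable_flexible[OF LF(2) d9[of c b r a p l]], simp_all)
  next
    case FL
    show ?thesis unfolding FL(1)
      by (rule colourable_Node[of _ c _ l "{}" _ _ b "{l, r}" _ "{c}"],
        rule colourable_flexible[OF FL(2) d7[of c l b p a r]], simp_all,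
        rule colourable_Leaf, simp_all)
  next
    case FF
    show ?thesis
      by (rule colourable_Node[of _ r _ l "{}" _ _ a "{l, c}" _ "{r}"],
        rule colourable_flexible[OF FF(1) d7[of r l a p b c]], simp_all,
        rule colourable_flexible[OF FF(2) d10[of l a r p c b]], simp_all)
  qed
next
  case (d7 p l r a b c)
  note [simp] = paletteD[OF d7] palette_def insert_commute
  show ?case using children
  proof (cases rule: child_cases)
    case LL
    show ?thesis unfolding LL
      by (rule colourable_cherry[of r b a]) (simp_all add: safe3_def safe_def)
  next
    case LF
    show ?thesis unfolding LF(1)
      by (rule colourable_Node[of _ r _ c "{}" _ _ b "{p, a}" _ "{r}"],
        rule colourable_Leaf, simp_all,
        rule colourable_flexible[OF LF(2) d2[of c b r p a l]], simp_all)
  next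
    case FL
    show ?thesis unfolding FL(1)
      by (rule colourable_Node[of _ c _ b "{}" _ _ a "{r, b}" _ "{c}"],
        rule colourable_flexible[OF FL(2) d5[of c l a b p r]], simp_all,
        rule colourable_Leaf, simp_all)
  next
    case FF
    show ?thesis
      by (rule colourable_Node[of _ r _ l "{}" _ _ c "{l, a}" _ "{p, r}"],
        rule colourable_flexible[OF FF(1) d3[of r l c p b a]], simp_all,
        rule colourable_flexible[OF FF(2) d10[of l c r p a b]], simp_all)
  qed
next
  case (d8 p l r a b c)
  note [simp] = paletteD[OF d8] palette_def insert_commute
  show ?case using children
  proof (cases rule: child_cases)
    case LL
    show ?thesis unfolding LL
      by (rule colourable_cherry[of b a c]) (simp_all add: safe3_def safe_def)
  next
    case LF
    show ?thesis unfolding LF(1)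
      by (rule colourable_Node[of _ b _ c "{c}" _ _ a "{p, b}" _ "{}"],
        rule colourable_Leaf, simp_all,
        rule colourable_flexible[OF LF(2) d6[of c a r b p l]], simp_all)
  next
    case FL
    show ?thesis unfolding FL(1)
      by (rule colourable_Node[of _ b _ l "{}" _ _ c "{l, r}" _ "{b}"],
        rule colourable_flexible[OF FL(2) d3[of b l c p a r]], simp_all,
        rule colourable_Leaf, simp_all)
  next
    case FF
    show ?thesis
      by (rule colourable_Node[of _ r _ b "{p, b}" _ _ p "{r, c}" _ "{}"],
        rule colourable_flexible[OF FF(1) d2[of r l p b a c]], simp_all,
        rule colourable_flexible[OF FF(2) d11[of b p r c a l]], simp_all)
  qed
next
  case (d9 p l r a b c)
  note [simp] = paletteD[OF d9] palette_def insert_commute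
  show ?case using children
  proof (cases rule: child_cases)
    case LL
    show ?thesis unfolding LL
      by (rule colourable_cherry[of a b c]) (simp_all add: safe3_def safe_def)
  next
    case LF
    show ?thesis unfolding LF(1)
      by (rule colourable_Node[of _ a _ c "{p, c}" _ _ b "{p, a}" _ "{}"],
        rule colourable_Leaf, simp_all,
        rule colourable_flexible[OF LF(2) d4[of c b r a p l]], simp_all)
  next
    case FL
    show ?thesis unfolding FL(1)
      by (rule colourable_Node[of _ c _ l "{}" _ _ b "{l, r}" _ "{c}"],
        rule colourable_flexible[OF FL(2) d7[of c l b p a r]], simp_all,
        rule colourable_Leaf, simp_all)
  next
    case FF
    show ?thesis
      by (rule colourable_Node[of _ r _ a "{}" _ _ c "{a, b}" _ "{p, r}"],
        rule colourable_flexible[OF FF(1) d5[of r l c a p b]], simp_all,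
        rule colourable_flexible[OF FF(2) d10[of a c r p b l]], simp_all)
  qed
next
  case (d10 p l r a b c)
  note [simp] = paletteD[OF d10] palette_def insert_commute
  show ?case using children
  proof (cases rule: child_cases)
    case LL
    show ?thesis unfolding LL
      by (rule colourable_cherry[of b p c]) (simp_all add: safe3_def safe_def)
  next
    case LF
    show ?thesis unfolding LF(1)
      by (rule colourable_Node[of _ b _ c "{c}" _ _ p "{r, a}" _ "{}"],
        rule colourable_Leaf, simp_all,
        rule colourable_flexible[OF LF(2) d7[of c p r b a l]], simp_all)
  next
    case FL
    show ?thesis unfolding FL(1)
      by (rule colourable_Node[of _ c _ b "{}" _ _ a "{r, b}" _ "{c}"],
        rule colourable_flexible[OF FL(2) d9[of c l a b p r]], simp_all,
        rule colourable_Leaf, simp_all)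
  next
    case FF
    show ?thesis
      by (rule colourable_Node[of _ c _ l "{}" _ _ p "{a, c}" _ "{c}"],
        rule colourable_flexible[OF FF(1) d11[of c l p b a r]], simp_all,
        rule colourable_flexible[OF FF(2) d12[of l p r c a b]], simp_all)
  qed
next
  case (d11 p l r a b c)
  note [simp] = paletteD[OF d11] palette_def insert_commute
  show ?case using children
  proof (cases rule: child_cases)
    case LL
    show ?thesis unfolding LL
      by (rule colourable_cherry[of r a c]) (simp_all add: safe3_def safe_def)
  next
    case LF
    show ?thesis unfolding LF(1)
      by (rule colourable_Node[of _ r _ c "{p, c}" _ _ a "{p, b}" _ "{}"],
        rule colourable_Leaf, simp_all,
        rule colourable_flexible[OF LF(2) d8[of c a r p b l]], simp_all)
  next
    case FL
    show ?thesis unfolding FL(1)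
      by (rule colourable_Node[of _ b _ a "{}" _ _ c "{r, a}" _ "{b}"],
        rule colourable_flexible[OF FL(2) d5[of b l c a p r]], simp_all,
        rule colourable_Leaf, simp_all)
  next
    case FF
    show ?thesis
      by (rule colourable_Node[of _ a _ b "{}" _ _ p "{l, a}" _ "{a}"],
        rule colourable_flexible[OF FF(1) d10[of a l p b r c]], simp_all,
        rule colourable_flexible[OF FF(2) d12[of b p r a l c]], simp_all)
  qed
next
  case (d12 p l r a b c)
  note [simp] = paletteD[OF d12] palette_def insert_commute
  show ?case using children
  proof (cases rule: child_cases)
    case LL
    show ?thesis unfolding LL
      by (rule colourable_cherry[of b a c]) (simp_all add: safe3_def safe_def)
  next
    case LF
    show ?thesis unfolding LF(1)
      by (rule colourable_Node[of _ b _ c "{c}" _ _ a "{p, b}" _ "{}"],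
        rule colourable_Leaf, simp_all,
        rule colourable_flexible[OF LF(2) d9[of c a r p b l]], simp_all)
  next
    case FL
    show ?thesis unfolding FL(1)
      by (rule colourable_Node[of _ b _ l "{}" _ _ c "{l, r}" _ "{p, b}"],
        rule colourable_flexible[OF FL(2) d3[of b l c p a r]], simp_all,
        rule colourable_Leaf, simp_all)
  next
    case FF
    show ?thesis
      by (rule colourable_Node[of _ c _ b "{b}" _ _ p "{a, b}" _ "{}"],
        rule colourable_flexible[OF FF(1) d8[of c l p b a r]], simp_all,
        rule colourable_flexible[OF FF(2) d3[of b p r c a l]], simp_all)
  qed
next
  case (d13 p l r a b c)
  note [simp] = paletteD[OF d13] palette_def insert_commute
  show ?case using children
  proof (cases rule: child_cases)
    case LL
    show ?thesis unfolding LL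
      by (rule colourable_cherry[of r b a]) (simp_all add: safe3_def safe_def)
  next
    case LF
    show ?thesis unfolding LF(1)
      by (rule colourable_Node[of _ r _ a "{a}" _ _ b "{p, c}" _ "{p}"],
        rule colourable_Leaf, simp_all,
        rule colourable_flexible[OF LF(2) d8[of a b r p c l]], simp_all)
  next
    case FL
    show ?thesis unfolding FL(1)
      by (rule colourable_Node[of _ c _ b "{}" _ _ a "{r, b}" _ "{c}"],
        rule colourable_flexible[OF FL(2) d5[of c l a b p r]], simp_all,
        rule colourable_Leaf, simp_all)
  next
    case FF
    show ?thesis
      by (rule colourable_Node[of _ b _ c "{}" _ _ p "{l, b}" _ "{b}"],
        rule colourable_flexible[OF FF(1) d10[of b l p c r a]], simp_all,
        rule colourable_flexible[OF FF(2) d12[of c p r b l a]], simp_all)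
  qed
qed

lemma flexible_Node: "flexible (Node t1 v t2)"
proof -
  have "(\<exists>x. t = Leaf x) \<or> flexible t" for t :: "'a btree"
  proof (induction t)
    case (Node t1 v t2)
    then show ?case unfolding flexible_def[of "Node t1 v t2"] by (auto intro: demand_split)
  qed simp
  then show ?thesis by blast
qed

section \<open>Closing the graph up at one leaf\<close>

text \<open>
  The three outer edges of a whole tree lead to one and the same vertex, which shows across each
  of them the colours of the two others and has to be safe itself.
\<close>

definition closes :: "'a btree \<Rightarrow> bool" where
  "closes t \<longleftrightarrow> (\<exists>ct P L R. fits t ct \<and> colours ct \<subseteq> {..<6} \<and> {P, L, R} \<subseteq> {..<6} \<and>
     star_ok ct P {L, R} L {P, R} R {P, L} \<and>
     safe3 P (seen_top ct L R) L (seen_left ct P R) R (seen_right ct P L))"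

text \<open>
  A cubic graph that consists of a plane binary tree, the cycle edges between consecutive leaves,
  and one further vertex \<open>r\<close> joined to the apex and to the first and the last leaf.
\<close>

lemma colour_closed_tree:
  assumes t: "distinct_tree t" "r \<notin> verts t" "closes t"
    and E: "attached E t r r r" "nbrs E r = {apex t, leftmost t, rightmost t}"
    and dist: "distinct [apex t, leftmost t, rightmost t]"
    and graph: "\<And>e. e \<in> E \<Longrightarrow> e \<subseteq> insert r (verts t) \<and> card e = 2"
  shows "star_chromatic_index (insert r (verts t)) E \<le> 6"
proof -
  obtain ct P L R where ct: "fits t ct" "colours ct \<subseteq> {..<6}" "{P, L, R} \<subseteq> {..<6}"
    and star_ok: "star_ok ct P {L, R} L {P, R} R {P, L}"
    and close: "safe3 P (seen_top ct L R) L (seen_left ct P R) R (seen_right ct P L)"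
    using t(3) unfolding closes_def by auto
  let ?c0 = "(\<lambda>_. 0)({r, apex t} := P, {r, leftmost t} := L, {r, rightmost t} := R)"
  have ne: "r \<noteq> apex t" "r \<noteq> leftmost t" "r \<noteq> rightmost t" using t(2) in_verts[of t] by metis+
  have "?c0 {r, apex t} = P" "?c0 {r, leftmost t} = L" "?c0 {rightmost t, r} = R"
    using dist ne by (auto simp: doubleton_eq_iff)
  from ex_realizes[OF t(1) ct(1) t(2) t(2) t(2) this]
  obtain c where c: "realizes c t ct r P r L r R" by blast
  have e3: "c {r, apex t} = P" "c {r, leftmost t} = L" "c {r, rightmost t} = R"
    using top_edge[OF c] left_edge[OF c] right_edge[OF c] by (simp_all add: insert_commute)
  have nb: "{r, y} \<in> E \<longleftrightarrow> y \<in> {apex t, leftmost t, rightmost t}" for y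
    using E(2) unfolding nbrs_def by auto
  have seen_r: "seen E c (apex t) r = {L, R}" "seen E c (leftmost t) r = {P, R}"
    "seen E c (rightmost t) r = {P, L}"
    using seen_three[OF nb dist, of c] e3 by simp_all
  have "vertex_ok E c x" if "x \<in> insert r (verts t)" for x
  proof (cases "x = r")
    case True
    have "vertex_ok E c r"
      by (rule vertex_okI[OF nb])
        (simp add: e3 seen_top_eq[OF c E(1)] seen_left_eq[OF c E(1)] seen_right_eq[OF c E(1)] close)
    then show ?thesis using True by simp
  next
    case False
    then show ?thesis
      using star_ok_imp_vertex_ok[OF c E(1), of x] star_ok that seen_r by simp
  qed
  then have star: "star_edge_coloring (insert r (verts t)) E c"
    using graph by (rule star_edge_coloringI)
  have "c e \<in> {..<6}" if eE: "e \<in> E" for e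
  proof -
    obtain x y where xy: "e = {x, y}" "x \<noteq> y" using graph[OF eE] by (auto simp: card_2_iff)
    then have "x \<in> verts t \<or> y \<in> verts t" using graph[OF eE] by auto
    then have "c e \<in> {P, L, R} \<union> colours ct"
      using realizes_colours[OF c E(1), of x y] realizes_colours[OF c E(1), of y x] eE xy(1)
      by (auto simp: insert_commute)
    then show ?thesis using ct by blast
  qed
  then show ?thesis by (intro star_chromatic_index_le[OF star]) blast
qed

text \<open>
  At the vertex where the outer edges meet, the top edge is safe because the piece shows neither
  \<open>L\<close> nor \<open>R\<close> above; the left and the right edge are safe because
  \<open>R\<close> is not shown on the left.
\<close>

lemma colourable_imp_closes:
  assumes "colourable t P {L, R} {L, R} L {P, a} R {P, L}" and d: "distinct [P, L, R, a]" "{P, L, R} \<subseteq> {..<6}"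
  shows "closes t"
proof -
  obtain ct where ct: "fits t ct" "colours ct \<subseteq> {..<6}" "star_ok ct P {L, R} L UNIV R {P, L}"
    "seen_top ct L R \<inter> {L, R} = {}" "seen_left ct P R = {P, a}"
    using assms(1) unfolding colourable_def by (elim exE conjE)
  have "star_ok ct P {L, R} L {P, R} R {P, L}" by (rule star_ok_mono[OF ct(3)]) simp_all
  moreover have "safe3 P (seen_top ct L R) L (seen_left ct P R) R (seen_right ct P L)"
    using ct(4,5) d(1) by (simp add: safe3_def safe_def)
  ultimately have "fits t ct \<and> colours ct \<subseteq> {..<6} \<and> {P, L, R} \<subseteq> {..<6} \<and>
     star_ok ct P {L, R} L {P, R} R {P, L} \<and>
     safe3 P (seen_top ct L R) L (seen_left ct P R) R (seen_right ct P L)"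
    using ct(1,2) d(2) by (intro conjI)
  then show ?thesis unfolding closes_def by (intro exI)
qed

lemma closes_Node: "closes (Node t1 v t2)"
proof (rule colourable_imp_closes)
  have "palette 0 1 2 3 4 5" by (simp add: palette_def)
  from d1[OF this] show "colourable (Node t1 v t2) 0 {1, 2} {1, 2} 1 {0, 3} 2 {0, 1}"
    using flexible_Node[of t1 v t2] unfolding flexible_def by (elim allE impE)
qed simp_all

section \<open>Branches of a finite tree\<close>

definition adj :: "'a set set \<Rightarrow> ('a \<times> 'a) set" where
  "adj F = {(x, y). {x, y} \<in> F}"

lemma adj_iff [simp]: "(x, y) \<in> adj F \<longleftrightarrow> {x, y} \<in> F"
  by (simp add: adj_def)

lemma adj_rtrancl_sym: "(x, y) \<in> (adj F)\<^sup>* \<Longrightarrow> (y, x) \<in> (adj F)\<^sup>*"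
  by (rule symD[OF sym_rtrancl]) (auto simp: sym_def insert_commute)

lemma path_edges_snoc: "p \<noteq> [] \<Longrightarrow> path_edges (p @ [z]) = insert {last p, z} (path_edges p)"
proof (cases p rule: rev_cases)
  case (snoc ps y)
  then show ?thesis using path_edges_append[of ps y "[z]"] by (auto simp: path_edges_Cons)
qed simp

lemma rtrancl_imp_path:
  assumes "(x, y) \<in> (adj F)\<^sup>*"
  shows "\<exists>p. p \<noteq> [] \<and> hd p = x \<and> last p = y \<and> distinct p \<and> path_edges p \<subseteq> F"
  using assms
proof (induction rule: rtrancl_induct)
  case base
  show ?case by (intro exI[of _ "[x]"]) auto
next
  case (step y z)
  then obtain p where p: "p \<noteq> []" "hd p = x" "last p = y" "distinct p" "path_edges p \<subseteq> F" by blast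
  show ?case
  proof (cases "z \<in> set p")
    case False
    then show ?thesis using p step(2)
      by (intro exI[of _ "p @ [z]"]) (auto simp: path_edges_snoc)
  next
    case True
    then obtain ps qs where pq: "p = ps @ z # qs" by (meson split_list)
    then have "path_edges (ps @ [z]) \<subseteq> F" using p(5) path_edges_append[of ps z qs] by blast
    then show ?thesis using p pq by (intro exI[of _ "ps @ [z]"]) (cases ps; auto)
  qed
qed

text \<open>
  The part of a tree that is cut off by the edge \<open>uv\<close>, on the side of
  \<open>v\<close>.
\<close>

definition branch :: "'a set set \<Rightarrow> 'a \<Rightarrow> 'a \<Rightarrow> 'a set" where
  "branch T u v = {x. (v, x) \<in> (adj (T - {{u, v}}))\<^sup>*}"

lemma branch_self [simp]: "v \<in> branch T u v"
  by (simp add: branch_def)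

lemma branch_step: "x \<in> branch T u v \<Longrightarrow> {x, y} \<in> T \<Longrightarrow> {x, y} \<noteq> {u, v} \<Longrightarrow> y \<in> branch T u v"
  unfolding branch_def mem_Collect_eq by (rule rtrancl_into_rtrancl[of _ x]) simp_all

lemma branch_induct [consumes 1, case_names base step]:
  assumes "x \<in> branch T u v" "Q v"
    and "\<And>y z. y \<in> branch T u v \<Longrightarrow> z \<in> branch T u v \<Longrightarrow> {y, z} \<in> T \<Longrightarrow> {y, z} \<noteq> {u, v} \<Longrightarrow> Q y \<Longrightarrow> Q z"
  shows "Q x"
proof -
  have "(v, x) \<in> (adj (T - {{u, v}}))\<^sup>*" using assms(1) by (simp add: branch_def)
  then have "x \<in> branch T u v \<and> Q x"
  proof (induction rule: rtrancl_induct)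
    case base show ?case using assms(2) by simp
  next
    case (step y z)
    then have "{y, z} \<in> T" "{y, z} \<noteq> {u, v}" by auto
    then show ?case using step(3) assms(3) branch_step by metis
  qed
  then show ?thesis by blast
qed

lemma branch_connected:
  assumes "x \<in> branch T u v" "y \<in> branch T u v"
  shows "(x, y) \<in> (adj {e \<in> T. e \<subseteq> branch T u v})\<^sup>*"
proof -
  have *: "(v, x) \<in> (adj {e \<in> T. e \<subseteq> branch T u v})\<^sup>*" if "x \<in> branch T u v" for x
    using that
  proof (induction rule: branch_induct)
    case (step y z)
    then show ?case by (auto intro: rtrancl_into_rtrancl)
  qed simp
  show ?thesis by (rule rtrancl_trans[OF adj_rtrancl_sym[OF *[OF assms(1)]] *[OF assms(2)]])
qed

lemma set_path_subset:
  assumes "path_edges p \<subseteq> F" "\<Union>F \<subseteq> S" "p \<noteq> []" "hd p \<in> S"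
  shows "set p \<subseteq> S"
proof (cases "2 \<le> length p")
  case True
  then show ?thesis using Union_path_edges[OF True] assms(1,2) by blast
next
  case False
  then show ?thesis using assms(3,4) by (cases p; cases "tl p") auto
qed

lemma card_nbrs:
  assumes "simple_graph V T"
  shows "card (nbrs T v) = vdegree T v"
proof -
  have "bij_betw (\<lambda>y. {v, y}) (nbrs T v) {e \<in> T. v \<in> e}"
  proof (rule bij_betwI')
    fix e assume "e \<in> {e \<in> T. v \<in> e}"
    then have "e \<in> T" "v \<in> e" "card e = 2" using assms unfolding simple_graph_def by auto
    then obtain y where "e = {v, y}" by (metis card_2_iff insert_commute insert_iff singletonD)
    then show "\<exists>y\<in>nbrs T v. e = {v, y}" using \<open>e \<in> T\<close> unfolding nbrs_def by blast
  qed (auto simp: nbrs_def doubleton_eq_iff)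
  then show ?thesis unfolding vdegree_def by (rule bij_betw_same_card)
qed

primrec leaf_list :: "'a btree \<Rightarrow> 'a list" where
  "leaf_list (Leaf x) = [x]"
| "leaf_list (Node l v r) = leaf_list l @ leaf_list r"

lemma leaf_list_ends: "leaf_list t \<noteq> []" "hd (leaf_list t) = leftmost t" "last (leaf_list t) = rightmost t"
  by (induction t) auto

lemma distinct_apexes:
  assumes "distinct_tree (Node l v r)" "u \<notin> verts (Node l v r)"
  shows "distinct [u, apex l, apex r]"
proof -
  have a: "apex l \<in> verts l" "apex r \<in> verts r" by simp_all
  have "verts l \<inter> verts r = {}" using assms(1) by simp
  then have "apex l \<noteq> apex r" using a by (metis disjoint_iff)
  then show ?thesis using assms(2) a by auto
qed

text \<open>
  The tree \<open>t\<close> is the branch of \<open>T\<close> below \<open>u\<close>, with some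
  order chosen for the two children of each vertex; the same is required of all subtrees.
\<close>

primrec hangs :: "'a set set \<Rightarrow> 'a \<Rightarrow> 'a btree \<Rightarrow> bool" where
  "hangs T u (Leaf x) \<longleftrightarrow> nbrs T x = {u} \<and> branch T u x = {x}"
| "hangs T u (Node l v r) \<longleftrightarrow> nbrs T v = {u, apex l, apex r} \<and>
     branch T u v = verts (Node l v r) \<and> hangs T v l \<and> hangs T v r"

lemma hangs_branch: "hangs T u t \<Longrightarrow> branch T u (apex t) = verts t"
  by (cases t) auto

locale finite_tree =
  fixes V :: "'a set" and T :: "'a set set"
  assumes tree: "tree V T"
begin

lemma simple: "simple_graph V T" and acyclic: "\<not> graph_cycle V T p"
  and connected: "u \<in> V \<Longrightarrow> v \<in> V \<Longrightarrow> \<exists>p. graph_path V T p \<and> hd p = u \<and> last p = v"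
  using tree unfolding tree_def graph_connected_def by auto

lemma edge_in_V: "{x, y} \<in> T \<Longrightarrow> x \<in> V \<and> y \<in> V \<and> x \<noteq> y"
  using simple unfolding simple_graph_def by fastforce

lemma Union_T: "\<Union>T \<subseteq> V"
  using simple unfolding simple_graph_def by blast

lemma branch_subset:
  assumes "{u, v} \<in> T"
  shows "branch T u v \<subseteq> V"
proof
  fix x assume "x \<in> branch T u v"
  then show "x \<in> V"
  proof (induction rule: branch_induct)
    case base
    show ?case using edge_in_V[OF assms] by blast
  next
    case (step y z)
    show ?case using edge_in_V[OF step(3)] by blast
  qed
qed

text \<open>
  A path from \<open>v\<close> to \<open>u\<close> that avoids the edge \<open>uv\<close> would
  form a cycle together with it.
\<close>

lemma bridge:
  assumes "{u, v} \<in> T"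
  shows "u \<notin> branch T u v"
proof
  assume "u \<in> branch T u v"
  then have "(v, u) \<in> (adj (T - {{u, v}}))\<^sup>*" by (simp add: branch_def)
  from rtrancl_imp_path[OF this]
  obtain p where p: "p \<noteq> []" "hd p = v" "last p = u" "distinct p" "path_edges p \<subseteq> T - {{u, v}}"
    by blast
  have uv: "u \<noteq> v" "v \<in> V" using edge_in_V[OF assms] by auto
  obtain x xs where px: "p = x # xs" using p(1) by (cases p) auto
  have "set p \<subseteq> V" using set_path_subset[of p T V] p Union_T uv by blast
  moreover have "cycle_edges p \<subseteq> T"
  proof -
    have "cycle_edges p = insert {last p, hd p} (path_edges p)"
      unfolding px cycle_edges_Cons using path_edges_snoc[of "x # xs" x] by simp
    then show ?thesis using p assms by (auto simp: insert_commute)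
  qed
  moreover have "3 \<le> length p"
  proof (rule ccontr)
    assume "\<not> 3 \<le> length p"
    then have "p = [v, u]" using p(1-3) uv by (cases p; cases "tl p"; cases "tl (tl p)") auto
    then show False using p(5) by (auto simp: path_edges_Cons insert_commute)
  qed
  ultimately show False using acyclic p(4) unfolding graph_cycle_def by blast
qed

lemma branch_mono:
  assumes "{u, v} \<in> T" "{v, w} \<in> T" "w \<noteq> u"
  shows "branch T v w \<subseteq> branch T u v"
proof
  fix x assume "x \<in> branch T v w"
  then show "x \<in> branch T u v"
  proof (induction rule: branch_induct)
    case base
    show ?case using branch_step[of v T u v w] assms by (auto simp: doubleton_eq_iff)
  next
    case (step y z)
    have "y \<noteq> v" "z \<noteq> v" using step(1,2) bridge[OF assms(2)] by auto
    then show ?case using branch_step[of y T u v z] step by (auto simp: doubleton_eq_iff)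
  qed
qed

text \<open>
  A common vertex of the two branches would give a way from \<open>w1\<close> through
  \<open>w2\<close> to \<open>v\<close> that avoids the edge \<open>v w1\<close>.
\<close>

lemma branch_disjoint:
  assumes "{v, w1} \<in> T" "{v, w2} \<in> T" "w1 \<noteq> w2"
  shows "branch T v w1 \<inter> branch T v w2 = {}"
proof (rule ccontr)
  assume "branch T v w1 \<inter> branch T v w2 \<noteq> {}"
  then obtain x where x: "x \<in> branch T v w1" "x \<in> branch T v w2" by blast
  have xw2: "(x, w2) \<in> (adj (T - {{v, w1}}))\<^sup>*" using x(2)
  proof (induction rule: branch_induct)
    case (step y z)
    have "y \<noteq> v" "z \<noteq> v" using step(1,2) bridge[OF assms(2)] by auto
    then have "(z, y) \<in> adj (T - {{v, w1}})" using step by (auto simp: doubleton_eq_iff insert_commute)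
    then show ?case using step(5) by (rule converse_rtrancl_into_rtrancl)
  qed simp
  have w2v: "(w2, v) \<in> adj (T - {{v, w1}})"
    using assms edge_in_V[OF assms(2)] by (auto simp: doubleton_eq_iff insert_commute)
  have "(w1, x) \<in> (adj (T - {{v, w1}}))\<^sup>*" using x(1) by (simp add: branch_def)
  then have "(w1, v) \<in> (adj (T - {{v, w1}}))\<^sup>*"
    by (rule rtrancl_trans[OF _ rtrancl_into_rtrancl[OF xw2 w2v]])
  then have "v \<in> branch T v w1" by (simp add: branch_def)
  then show False using bridge[OF assms(1)] by contradiction
qed

lemma branch_cover:
  assumes "{u, v} \<in> T" "nbrs T v = insert u W"
  shows "branch T u v \<subseteq> insert v (\<Union>w\<in>W. branch T v w)"
proof
  fix x assume "x \<in> branch T u v"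
  then show "x \<in> insert v (\<Union>w\<in>W. branch T v w)"
  proof (induction rule: branch_induct)
    case (step y z)
    show ?case
    proof (cases "y = v")
      case True
      then have "z \<in> nbrs T v" "z \<noteq> u" using step(3,4) by (auto simp: nbrs_def insert_commute)
      then have "z \<in> W" using assms(2) by simp
      then show ?thesis using branch_self[of z T v] by blast
    next
      case False
      with step(5) obtain w where w: "w \<in> W" "y \<in> branch T v w" by (meson UN_E insertE)
      show ?thesis
      proof (cases "{y, z} = {v, w}")
        case True
        with \<open>y \<noteq> v\<close> have "z = v" by (simp add: doubleton_eq_iff)
        then show ?thesis by simp
      next
        case False
        then have "z \<in> branch T v w" by (rule branch_step[OF w(2) step(3)])
        then show ?thesis using w(1) by blast
      qed
    qed
  qed simp
qed

lemma two_branches: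
  assumes "{u, v} \<in> T"
  shows "V = branch T u v \<union> branch T v u" "branch T u v \<inter> branch T v u = {}"
proof -
  have uv: "{v, u} \<in> T" "{v, u} = {u, v}" using assms by (auto simp: insert_commute)
  show "branch T u v \<inter> branch T v u = {}"
  proof (rule ccontr)
    assume "branch T u v \<inter> branch T v u \<noteq> {}"
    then obtain x where x: "(v, x) \<in> (adj (T - {{u, v}}))\<^sup>*" "(u, x) \<in> (adj (T - {{u, v}}))\<^sup>*"
      unfolding branch_def uv(2) by blast
    have "(v, u) \<in> (adj (T - {{u, v}}))\<^sup>*" by (rule rtrancl_trans[OF x(1) adj_rtrancl_sym[OF x(2)]])
    then show False using bridge[OF assms] unfolding branch_def by simp
  qed
  have "x \<in> branch T u v \<union> branch T v u" if xV: "x \<in> V" for x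
  proof -
    obtain p where p: "graph_path V T p" "hd p = v" "last p = x"
      using connected[of v x] edge_in_V[OF assms] xV by blast
    have *: "last p \<in> branch T u v \<union> branch T v u" if "p \<noteq> []" "path_edges p \<subseteq> T" "hd p \<in> branch T u v \<union> branch T v u" for p
      using that
    proof (induction p rule: induct_list012)
      case (3 y z zs)
      have "{y, z} \<in> T" using 3 by (auto simp: path_edges_Cons)
      then have "z \<in> branch T u v \<union> branch T v u"
        using 3(5) branch_step[of y T u v z] branch_step[of y T v u z]
        by (cases "{y, z} = {u, v}") (auto simp: doubleton_eq_iff insert_commute)
      then show ?case using 3 by (auto simp: path_edges_Cons)
    qed auto
    have "p \<noteq> []" "path_edges p \<subseteq> T" using p(1) unfolding graph_path_def by auto
    then show ?thesis using *[of p] p(2,3) by simp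
  qed
  then show "V = branch T u v \<union> branch T v u"
    using branch_subset[OF assms] branch_subset[OF uv(1)] by blast
qed

lemma ex_hanging_tree:
  assumes deg: "\<And>x. x \<in> V \<Longrightarrow> vdegree T x = 1 \<or> vdegree T x = 3"
    and "{u, v} \<in> T"
  shows "\<exists>t. apex t = v \<and> hangs T u t \<and> distinct_tree t"
  using assms(2)
proof (induction "card (branch T u v)" arbitrary: u v rule: less_induct)
  case less
  have fin: "finite (branch T u v)"
    using branch_subset[OF less(2)] simple unfolding simple_graph_def by (auto intro: finite_subset)
  have vV: "v \<in> V" using edge_in_V[OF less(2)] by blast
  have un: "u \<in> nbrs T v" using less(2) by (simp add: nbrs_def insert_commute)
  have "card (nbrs T v) = 1 \<or> card (nbrs T v) = 3"
    using deg[OF vV] card_nbrs[OF simple] by simp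
  then show ?case
  proof
    assume "card (nbrs T v) = 1"
    then have n: "nbrs T v = insert u {}" using un by (auto simp: card_1_singleton_iff)
    then have "branch T u v = {v}" using branch_cover[OF less(2) n] by auto
    then show ?case using n by (intro exI[of _ "Leaf v"]) auto
  next
    assume "card (nbrs T v) = 3"
    then have "card (nbrs T v - {u}) = 2" using un by (simp add: card.infinite card_Diff_singleton)
    then obtain w1 w2 where w: "nbrs T v - {u} = {w1, w2}" "w1 \<noteq> w2" by (auto simp: card_2_iff)
    then have n: "nbrs T v = insert u {w1, w2}" using un by blast
    have e: "{v, w1} \<in> T" "{v, w2} \<in> T" "w1 \<noteq> u" "w2 \<noteq> u" using w n unfolding nbrs_def by auto
    note sub = branch_mono[OF less(2) e(1,3)] branch_mono[OF less(2) e(2,4)]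
    have out: "v \<notin> branch T v w1" "v \<notin> branch T v w2" using bridge e by auto
    have "branch T v w1 \<subset> branch T u v" "branch T v w2 \<subset> branch T u v"
      using sub out branch_self[of v T u] by blast+
    then have "card (branch T v w1) < card (branch T u v)" "card (branch T v w2) < card (branch T u v)"
      using fin psubset_card_mono by blast+
    then obtain l r where l: "apex l = w1" "hangs T v l" "distinct_tree l"
      and r: "apex r = w2" "hangs T v r" "distinct_tree r"
      using less(1)[of v w1] less(1)[of v w2] e(1,2) by blast
    have vs: "verts l = branch T v w1" "verts r = branch T v w2"
      using hangs_branch[OF l(2)] hangs_branch[OF r(2)] l(1) r(1) by simp_all
    have "branch T u v = verts (Node l v r)"
      using branch_cover[OF less(2) n] sub vs branch_self[of v T u] by auto
    then have "hangs T u (Node l v r)" using n l r by simp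
    moreover have "distinct_tree (Node l v r)"
      using l r out vs branch_disjoint[OF e(1,2) w(2)] by simp
    ultimately show ?case by (intro exI[of _ "Node l v r"]) simp
  qed
qed

lemma leaves_iff: "x \<in> leaves V T \<longleftrightarrow> x \<in> V \<and> card (nbrs T x) = 1"
  by (simp add: leaves_def card_nbrs[OF simple])

lemma hangs_leaves:
  assumes "hangs T u t" "distinct_tree t" "u \<notin> verts t" "verts t \<subseteq> V"
  shows "set (leaf_list t) = verts t \<inter> leaves V T"
  using assms
proof (induction t arbitrary: u)
  case (Leaf x)
  then show ?case by (auto simp: leaves_iff)
next
  case (Node l v r)
  have "distinct [u, apex l, apex r]" using Node.prems(2,3) by (rule distinct_apexes)
  then have "v \<notin> leaves V T" using Node.prems(1) by (simp add: leaves_iff)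
  moreover have "set (leaf_list l) = verts l \<inter> leaves V T"
    using Node.prems by (intro Node.IH(1)[of v]) auto
  moreover have "set (leaf_list r) = verts r \<inter> leaves V T"
    using Node.prems by (intro Node.IH(2)[of v]) auto
  ultimately show ?case by auto
qed

text \<open>
  An inner vertex of a path has two neighbours on it, a leaf has only one.
\<close>

lemma path_meets_leaves:
  assumes "distinct p" "path_edges p \<subseteq> T" "p \<noteq> []" "x \<in> set p" "x \<in> leaves V T"
  shows "x = hd p \<or> x = last p"
proof (rule ccontr)
  assume "\<not> ?thesis"
  obtain ps qs where pq: "p = ps @ x # qs" using assms(4) by (meson split_list)
  with \<open>\<not> ?thesis\<close> have ne: "ps \<noteq> []" "qs \<noteq> []" by auto
  obtain y ps' where ps: "ps = ps' @ [y]" using ne by (meson rev_exhaust)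
  obtain z qs' where qs: "qs = z # qs'" using ne by (cases qs) auto
  have "path_edges p = path_edges (ps' @ [y]) \<union> path_edges (y # x # z # qs')"
    using path_edges_append[of ps' y "x # z # qs'"] pq ps qs by simp
  then have "{y, x} \<in> T" "{x, z} \<in> T" using assms(2) by (auto simp: path_edges_Cons)
  then have "y \<in> nbrs T x" "z \<in> nbrs T x" by (auto simp: nbrs_def insert_commute)
  moreover have "y \<noteq> z" using assms(1) pq ps qs by auto
  ultimately have "card (nbrs T x) \<noteq> 1" by (auto simp: card_1_singleton_iff)
  then show False using assms(5) leaves_iff by blast
qed

end

section \<open>The leaves of a branch are consecutive on the adjoint cycle\<close>

lemma cycle_edges_rotate: "cycle_edges (xs @ ys) = cycle_edges (ys @ xs)"
proof (cases "xs = [] \<or> ys = []")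
  case False
  then obtain x xs' y ys' where "xs = x # xs'" "ys = y # ys'" by (meson list.exhaust)
  then show ?thesis
    using path_edges_append[of "x # xs'" y "ys' @ [x]"] path_edges_append[of "y # ys'" x "xs' @ [y]"]
    by (simp add: cycle_edges_Cons Un_commute)
qed auto

text \<open>
  A Halin graph whose adjoint cycle is listed starting from a leaf \<open>r\<close>, which serves
  as the root.
\<close>

locale halin = finite_tree +
  fixes C :: "'a set set" and pos :: "'a \<Rightarrow> complex" and \<gamma> :: "'a set \<Rightarrow> real \<Rightarrow> complex"
    and r :: 'a and q :: "'a list"
  assumes plane: "plane_graph V (T \<union> C) pos \<gamma>"
    and exterior: "frontier (outside (drawing V (T \<union> C) pos \<gamma>)) = drawing (leaves V T) C pos \<gamma>"
    and cycle: "C = cycle_edges (r # q)" "distinct (r # q)" "set (r # q) = leaves V T" "2 \<le> length q"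
begin

text \<open>
  A common edge would join two leaves of the tree, and then the tree would have no other vertices.
\<close>

lemma no_common_edges: "T \<inter> C = {}"
proof (rule ccontr)
  assume "T \<inter> C \<noteq> {}"
  then obtain e where e: "e \<in> T" "e \<in> C" by blast
  have "e \<subseteq> leaves V T"
    using e(2) Union_path_edges[of "r # q @ [r]"] cycle(3) unfolding cycle(1) cycle_edges_Cons by auto
  moreover have "card e = 2" using e(1) simple unfolding simple_graph_def by blast
  ultimately obtain x y where xy: "e = {x, y}" "x \<in> leaves V T" "y \<in> leaves V T"
    by (auto simp: card_2_iff)
  have only: "nbrs T a = insert b {}" if ab: "a \<in> leaves V T" "{a, b} \<in> T" for a b
  proof -
    obtain d where "nbrs T a = {d}" using leaves_iff ab(1) by (auto simp: card_1_singleton_iff)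
    moreover have "b \<in> nbrs T a" using ab(2) by (simp add: nbrs_def)
    ultimately show ?thesis by simp
  qed
  have "nbrs T x = insert y {}" "nbrs T y = insert x {}"
    using only[of x y] only[of y x] xy e(1) by (simp_all add: insert_commute)
  then have "branch T x y \<subseteq> {y}" "branch T y x \<subseteq> {x}"
    using branch_cover[of x y "{}"] branch_cover[of y x "{}"] e(1) xy(1) by (auto simp: insert_commute)
  then have "V \<subseteq> {x, y}" using two_branches(1)[of x y] e(1) xy(1) by auto
  then have "set (r # q) \<subseteq> {x, y}" using cycle(3) unfolding leaves_def by auto
  then have "card (set (r # q)) \<le> card {x, y}" by (intro card_mono) simp_all
  also have "\<dots> \<le> 2" by (simp add: card_insert_if)
  finally have "card (set (r # q)) \<le> 2" .
  then show False using distinct_card[OF cycle(2)] cycle(4) by simp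
qed

lemma branch_path:
  assumes "x \<in> branch T u v" "y \<in> branch T u v"
  shows "\<exists>p. p \<noteq> [] \<and> hd p = x \<and> last p = y \<and> distinct p \<and> path_edges p \<subseteq> T \<and> set p \<subseteq> branch T u v"
proof -
  obtain p where p: "p \<noteq> []" "hd p = x" "last p = y" "distinct p"
    "path_edges p \<subseteq> {e \<in> T. e \<subseteq> branch T u v}"
    by (rule exE[OF rtrancl_imp_path[OF branch_connected[OF assms]]]) blast
  have "set p \<subseteq> branch T u v" by (rule set_path_subset[OF p(5)]) (use p assms in auto)
  then show ?thesis using p by blast
qed

text \<open>
  If \<open>y\<close> were not in the branch, the path between \<open>a\<close> and
  \<open>b\<close> in the branch and the path between \<open>y\<close> and \<open>r\<close>
  outside it would be disjoint, although their ends interleave on the cycle.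
\<close>

lemma branch_interval:
  assumes uv: "{u, v} \<in> T" "r \<notin> branch T u v"
    and q: "q = A @ a # B @ y # B' @ b # D" and ab: "a \<in> branch T u v" "b \<in> branch T u v"
  shows "y \<in> branch T u v"
proof (rule ccontr)
  assume y: "y \<notin> branch T u v"
  let ?xs = "B @ y # B'" and ?ys = "D @ r # A"
  have rot: "cycle_edges (a # ?xs @ b # ?ys) = C"
    using cycle_edges_rotate[of "a # ?xs @ b # D" "r # A"] cycle(1) q by simp
  have set_eq: "set (a # ?xs @ b # ?ys) = leaves V T" using cycle(3) q by auto
  have dist: "distinct (a # ?xs @ b # ?ys)" using cycle(2) q by auto
  have V: "y \<in> V" "r \<in> V" using set_eq unfolding leaves_def by auto
  then have yr: "y \<in> branch T v u" "r \<in> branch T v u" using two_branches(1)[OF uv(1)] y uv(2) by auto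
  obtain p where p: "p \<noteq> []" "hd p = a" "last p = b" "distinct p" "path_edges p \<subseteq> T" "set p \<subseteq> branch T u v"
    using branch_path[OF ab] by blast
  obtain d where d: "d \<noteq> []" "hd d = y" "last d = r" "distinct d" "path_edges d \<subseteq> T" "set d \<subseteq> branch T v u"
    using branch_path[OF yr] by blast
  have "set p \<inter> leaves V T = {a, b}"
    using path_meets_leaves[OF p(4,5,1)] p(1-3) set_eq hd_in_set[OF p(1)] last_in_set[OF p(1)] by auto
  moreover have "set d \<inter> leaves V T = {hd d, last d}"
    using path_meets_leaves[OF d(4,5,1)] d(1-3) set_eq hd_in_set[OF d(1)] last_in_set[OF d(1)] by auto
  moreover have "set d \<inter> set p = {}" using p(6) d(6) two_branches(2)[OF uv(1)] by blast
  ultimately show False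
    using no_interleaved_paths[OF plane no_common_edges rot[symmetric] dist, folded set_eq, of p d]
      exterior p d set_eq by auto
qed

text \<open>
  Since the leaves of each subtree are consecutive on the cycle, children that come in the wrong
  order can be exchanged, from the apex downwards.
\<close>

lemma reorder:
  assumes "hangs T u t" "distinct_tree t" "{u, apex t} \<in> T" "r \<notin> verts t"
    and "set s = set (leaf_list t)" "q = A @ s @ D"
  shows "\<exists>t'. hangs T u t' \<and> distinct_tree t' \<and> apex t' = apex t \<and> verts t' = verts t \<and> leaf_list t' = s"
  using assms
proof (induction t arbitrary: u s A D)
  case (Leaf x)
  have "distinct s" using cycle(2) Leaf.prems by auto
  then have "s = [x]" using Leaf.prems(5) by (cases s; cases "tl s") auto
  then show ?case using Leaf.prems by (intro exI[of _ "Leaf x"]) auto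
next
  case (Node l v w)
  have dist: "distinct s" using cycle(2) Node.prems by auto
  have E: "{v, apex l} \<in> T" "{v, apex w} \<in> T" using Node.prems(1) unfolding hangs.simps nbrs_def by auto
  have br: "branch T v (apex l) = verts l" "branch T v (apex w) = verts w"
    using Node.prems(1) hangs_branch[of T v l] hangs_branch[of T v w] by simp_all
  have nr: "r \<notin> verts l" "r \<notin> verts w" using Node.prems(4) by auto
  have sub: "set (leaf_list t) \<subseteq> verts t" for t :: "'a btree" by (induction t) auto
  have disj: "verts l \<inter> verts w = {}" using Node.prems(2) by auto
  \<comment> \<open>The child that contains the first leaf of \<open>s\<close> has to come first: a later leaf of it, after one of the
    other child, would contradict the previous lemma.\<close>
  have split: "\<exists>s1 s2. s = s1 @ s2 \<and> set s1 = set (leaf_list t1) \<and> set s2 = set (leaf_list t2)"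
    if t12: "{t1, t2} = {l, w}" and hd: "hd s \<in> verts t1" for t1 t2
  proof -
    let ?P = "\<lambda>x. x \<in> verts t1"
    have d12: "verts t1 \<inter> verts t2 = {}" using t12 disj by (auto simp: doubleton_eq_iff)
    have un: "set s = set (leaf_list t1) \<union> set (leaf_list t2)"
      using t12 Node.prems(5) by (auto simp: doubleton_eq_iff)
    have s0: "s \<noteq> []" using un leaf_list_ends(1)[of t1] by auto
    have "\<not> ?P x" if x: "x \<in> set (dropWhile ?P s)" for x
    proof
      assume Px: "?P x"
      obtain y ys where ys: "dropWhile ?P s = y # ys" using x by (cases "dropWhile ?P s") auto
      then have y: "\<not> ?P y" by (metis hd_dropWhile list.distinct(1) list.sel(1))
      then have "x \<in> set ys" using x Px ys by auto
      then obtain ys1 ys2 where ys': "ys = ys1 @ x # ys2" by (meson split_list)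
      obtain h tk where h: "takeWhile ?P s = h # tk"
        using s0 hd by (cases s) auto
      then have Ph: "?P h" by (metis list.set_intros(1) set_takeWhileD)
      have "s = h # tk @ y # ys1 @ x # ys2"
        using takeWhile_dropWhile_id[of ?P s] h ys ys' by simp
      then have "q = A @ h # tk @ y # ys1 @ x # (ys2 @ D)" using Node.prems(6) by simp
      moreover have "{v, apex t1} \<in> T" "branch T v (apex t1) = verts t1" "r \<notin> verts t1"
        using t12 E br nr by (auto simp: doubleton_eq_iff)
      ultimately show False
        using branch_interval[of v "apex t1" A h tk y ys1 x "ys2 @ D"] Ph Px y by simp
    qed
    then have "set (dropWhile ?P s) \<subseteq> set (leaf_list t2)"
      using un sub[of t1] set_dropWhileD[of _ ?P s] by blast
    moreover have "set (takeWhile ?P s) \<subseteq> set (leaf_list t1)"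
      using un sub[of t2] d12 set_takeWhileD[of _ ?P s] by blast
    moreover have "set s = set (takeWhile ?P s) \<union> set (dropWhile ?P s)"
      by (metis set_append takeWhile_dropWhile_id)
    ultimately have "set (takeWhile ?P s) = set (leaf_list t1)" "set (dropWhile ?P s) = set (leaf_list t2)"
      using un sub[of t1] sub[of t2] d12 by blast+
    then show ?thesis by (metis takeWhile_dropWhile_id)
  qed
  have hl: "hangs T v l" "hangs T v w" "distinct_tree l" "distinct_tree w" using Node.prems by auto
  have "s \<noteq> []" using Node.prems(5) leaf_list_ends(1)[of l] by auto
  then have "hd s \<in> verts l \<or> hd s \<in> verts w"
    using Node.prems(5) sub[of l] sub[of w] hd_in_set[of s] by auto
  then show ?case
  proof
    assume "hd s \<in> verts l"
    then obtain s1 s2 where s: "s = s1 @ s2" "set s1 = set (leaf_list l)" "set s2 = set (leaf_list w)"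
      using split[of l w] by blast
    obtain l' where l': "hangs T v l'" "distinct_tree l'" "apex l' = apex l" "verts l' = verts l" "leaf_list l' = s1"
      using Node.IH(1)[OF hl(1,3) E(1) nr(1) s(2), of A "s2 @ D"] Node.prems(6) s(1) by auto
    obtain w' where w': "hangs T v w'" "distinct_tree w'" "apex w' = apex w" "verts w' = verts w" "leaf_list w' = s2"
      using Node.IH(2)[OF hl(2,4) E(2) nr(2) s(3), of "A @ s1" D] Node.prems(6) s(1) by auto
    show ?thesis using Node.prems l' w' s by (intro exI[of _ "Node l' v w'"]) auto
  next
    assume "hd s \<in> verts w"
    then obtain s1 s2 where s: "s = s1 @ s2" "set s1 = set (leaf_list w)" "set s2 = set (leaf_list l)"
      using split[of w l] by (metis insert_commute)
    obtain l' where l': "hangs T v l'" "distinct_tree l'" "apex l' = apex l" "verts l' = verts l" "leaf_list l' = s2"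
      using Node.IH(1)[OF hl(1,3) E(1) nr(1) s(3), of "A @ s1" D] Node.prems(6) s(1) by auto
    obtain w' where w': "hangs T v w'" "distinct_tree w'" "apex w' = apex w" "verts w' = verts w" "leaf_list w' = s1"
      using Node.IH(2)[OF hl(2,4) E(2) nr(2) s(2), of A "s2 @ D"] Node.prems(6) s(1) by auto
    show ?thesis using Node.prems l' w' s by (intro exI[of _ "Node w' v l'"]) (auto simp: insert_commute Un_commute)
  qed
qed

end

section \<open>Cubic Halin graphs as closed-up binary trees\<close>

text \<open>
  How the adjoint cycle is given to a subtree: the list of its leaves, extended by the leaf before
  and the leaf after them, inherits this property from the list of all leaves with the root at
  both ends.
\<close>

definition cycle_windows :: "'a set set \<Rightarrow> 'a list \<Rightarrow> bool" where
  "cycle_windows C xs \<longleftrightarrow> (\<forall>A x y z B. xs = A @ x # y # z # B \<longrightarrow> x \<noteq> z \<and> nbrs C y = {x, z})"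

lemma cycle_windows_infix: "cycle_windows C (A @ xs @ B) \<Longrightarrow> cycle_windows C xs"
  unfolding cycle_windows_def by (metis append.assoc append_Cons)

lemma cycle_windows_cycle:
  assumes "distinct (r # q)" "2 \<le> length q"
  shows "cycle_windows (cycle_edges (r # q)) (r # q @ [r])"
  unfolding cycle_windows_def
proof (intro allI impI)
  fix A x y z B assume eq: "r # q @ [r] = A @ x # y # z # B"
  obtain A' where A': "A @ [x] = r # A'" using eq by (cases A) auto
  obtain B' where B': "z # B = B' @ [r]" using eq by (cases B rule: rev_cases) auto
  have "r # q @ [r] = (A @ [x]) @ y # (z # B)" using eq by simp
  then have "q @ [r] = (A' @ y # B') @ [r]" unfolding A' B' by simp
  then have q: "q = A' @ y # B'" by (simp only: append_same_eq)
  have y: "y \<notin> set (A @ [x])" "y \<notin> set (z # B)" unfolding A' B' using assms(1) q by auto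
  have dec: "path_edges (A @ x # y # z # B) = path_edges (A @ [x]) \<union> {{x, y}, {y, z}} \<union> path_edges (z # B)"
    using path_edges_append[of A x "y # z # B"] by (auto simp: path_edges_Cons)
  have nin: "{y, w} \<notin> path_edges (A @ [x]) \<and> {y, w} \<notin> path_edges (z # B)" for w
    using y Union_path_edges_subset[of "A @ [x]"] Union_path_edges_subset[of "z # B"]
    by (meson UnionI insertI1 subsetD)
  have "{y, w} = {x, y} \<longleftrightarrow> w = x" "{y, w} = {y, z} \<longleftrightarrow> w = z" for w
    by (auto simp: doubleton_eq_iff)
  then have "{y, w} \<in> path_edges (A @ x # y # z # B) \<longleftrightarrow> w = x \<or> w = z" for w
    unfolding dec using nin[of w] by simp
  then have "nbrs (cycle_edges (r # q)) y = {x, z}"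
    unfolding nbrs_def cycle_edges_Cons append_Cons eq by auto
  moreover have "x \<noteq> z"
  proof
    assume xz: "x = z"
    show False
    proof (cases A)
      case Nil
      then have "x = r" "A' = []" using A' by auto
      then show False using B' xz assms q by (cases B') auto
    next
      case (Cons a A2)
      then have "A' = A2 @ [x]" using A' by simp
      then have "x \<in> set A'" by simp
      moreover have "z \<in> set B' \<or> z = r" using B' by (cases B') auto
      ultimately show False using xz assms(1) q by auto
    qed
  qed
  ultimately show "x \<noteq> z \<and> nbrs (cycle_edges (r # q)) y = {x, z}" by blast
qed

text \<open>
  The edges of \<open>T\<close> are described by \<open>hangs\<close> and those of
  \<open>C\<close> by the list of leaves. The outer vertices on the left and on the right of a
  subtree are the neighbouring entries of that list.
\<close>

lemma hangs_attached:
  assumes "hangs T u t" "distinct_tree t" "u \<notin> verts t"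
    and "cycle_windows C (a # leaf_list t @ [b])"
    and "\<And>v. v \<in> verts t \<Longrightarrow> v \<notin> set (leaf_list t) \<Longrightarrow> nbrs C v = {}"
    and "\<And>x. t = Leaf x \<Longrightarrow> u \<noteq> a \<and> u \<noteq> b"
    and "\<And>v. v \<in> verts t \<Longrightarrow> v \<notin> set (leaf_list t) \<Longrightarrow> v \<noteq> a \<and> v \<noteq> b"
  shows "attached (T \<union> C) t u a b"
  using assms
proof (induction t arbitrary: u a b)
  case (Leaf x)
  have "cycle_windows C ([] @ a # x # b # [])" using Leaf.prems(4) by simp
  then have "a \<noteq> b" "nbrs C x = {a, b}" unfolding cycle_windows_def by blast+
  moreover have "{x, y} \<in> T \<union> C \<longleftrightarrow> y \<in> nbrs T x \<union> nbrs C x" for y by (simp add: nbrs_def)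
  ultimately show ?case using Leaf by auto
next
  case (Node l v w)
  have sub: "set (leaf_list t) \<subseteq> verts t" for t :: "'a btree" by (induction t) auto
  have disj: "verts l \<inter> verts w = {}" "v \<notin> verts l" "v \<notin> verts w" using Node.prems(2) by auto
  have vl: "v \<notin> set (leaf_list (Node l v w))" using disj sub[of l] sub[of w] by auto
  obtain Lw where Lw: "leaf_list w = leftmost w # Lw" by (metis leaf_list_ends(1,2) list.collapse)
  obtain Ll where Ll: "leaf_list l = Ll @ [rightmost l]" by (metis leaf_list_ends(1,3) append_butlast_last_id)
  have "cycle_windows C ([] @ (a # leaf_list l @ [leftmost w]) @ (Lw @ [b]))"
    using Node.prems(4) Lw by simp
  then have w1: "cycle_windows C (a # leaf_list l @ [leftmost w])" by (rule cycle_windows_infix)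
  have "cycle_windows C ((a # Ll) @ (rightmost l # leaf_list w @ [b]) @ [])"
    using Node.prems(4) Ll by simp
  then have w2: "cycle_windows C (rightmost l # leaf_list w @ [b])" by (rule cycle_windows_infix)
  have nl: "x \<notin> set (leaf_list (Node l v w))" if "x \<in> verts l" "x \<notin> set (leaf_list l)" for x
    using that disj sub[of w] by auto
  have nw: "x \<notin> set (leaf_list (Node l v w))" if "x \<in> verts w" "x \<notin> set (leaf_list w)" for x
    using that disj sub[of l] by auto
  have vab: "v \<noteq> a" "v \<noteq> b" "v \<noteq> leftmost w" "v \<noteq> rightmost l"
    using Node.prems(7)[of v] vl disj in_verts by auto
  have cross: "x \<noteq> leftmost w" if "x \<in> verts l" for x
    using that disj in_verts(2)[of w] by blast
  have cross2: "x \<noteq> rightmost l" if "x \<in> verts w" for x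
    using that disj in_verts(3)[of l] by blast
  have "attached (T \<union> C) l v a (leftmost w)"
  proof (rule Node.IH(1)[OF _ _ _ w1])
    show "hangs T v l" "distinct_tree l" "v \<notin> verts l" using Node.prems disj by auto
    show "nbrs C x = {}" "x \<noteq> a \<and> x \<noteq> leftmost w" if "x \<in> verts l" "x \<notin> set (leaf_list l)" for x
      using Node.prems(5,7)[of x] that nl[OF that] cross by auto
  qed (use vab in auto)
  moreover have "attached (T \<union> C) w v (rightmost l) b"
  proof (rule Node.IH(2)[OF _ _ _ w2])
    show "hangs T v w" "distinct_tree w" "v \<notin> verts w" using Node.prems disj by auto
    show "nbrs C x = {}" "x \<noteq> rightmost l \<and> x \<noteq> b" if "x \<in> verts w" "x \<notin> set (leaf_list w)" for x
      using Node.prems(5,7)[of x] that nw[OF that] cross2 by auto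
  qed (use vab in auto)
  moreover have "nbrs C v = {}" using Node.prems(5)[of v] vl by simp
  then have "{v, y} \<in> T \<union> C \<longleftrightarrow> y \<in> {u, apex l, apex w}" for y
    using Node.prems(1) by (auto simp: nbrs_def)
  moreover have "distinct [u, apex l, apex w]"
    using Node.prems(2,3) by (rule distinct_apexes)
  ultimately show ?case by simp
qed

text \<open>
  The first leaf of a listing of the adjoint cycle serves as \<open>r\<close>. Any binary tree
  that describes the rest of the characteristic tree can be reordered to fit the listing.
\<close>

lemma cubic_halin_closed_tree:
  fixes V :: "'a set" and T C :: "'a set set"
  assumes H: "halin_graph V T C pos \<gamma>" and reg: "regular 3 V (T \<union> C)"
  obtains r t where "distinct_tree t" "r \<notin> verts t" "V = insert r (verts t)" "attached (T \<union> C) t r r r"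
    "nbrs (T \<union> C) r = {apex t, leftmost t, rightmost t}" "distinct [apex t, leftmost t, rightmost t]"
proof -
  have plane: "plane_graph V (T \<union> C) pos \<gamma>" and tree: "tree V T"
    and deg: "\<And>v. v \<in> V \<Longrightarrow> vdegree T v = 1 \<or> 3 \<le> vdegree T v"
    and cyc: "cycle_graph (leaves V T) C"
    and ext: "frontier (outside (drawing V (T \<union> C) pos \<gamma>)) = drawing (leaves V T) C pos \<gamma>"
    using H unfolding halin_graph_def by auto
  obtain p where p: "3 \<le> length p" "distinct p" "set p = leaves V T" "cycle_edges p = C"
    using cyc unfolding cycle_graph_def by blast
  then obtain r q where pq: "p = r # q" by (cases p) auto
  interpret finite_tree V T by (unfold_locales, rule tree)
  interpret halin V T C pos \<gamma> r q
    by unfold_locales (use plane ext p pq in auto)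
  have finE: "finite (T \<union> C)"
  proof -
    have "T \<union> C \<subseteq> Pow V" "finite V" using plane unfolding plane_graph_def simple_graph_def by auto
    then show ?thesis by (meson finite_Pow_iff finite_subset)
  qed
  have deg3: "vdegree T x = 1 \<or> vdegree T x = 3" if "x \<in> V" for x
  proof -
    have "vdegree T x \<le> vdegree (T \<union> C) x"
      unfolding vdegree_def using finE by (intro card_mono) auto
    then show ?thesis using deg[OF that] reg that unfolding regular_def by fastforce
  qed
  have r: "r \<in> leaves V T" using p pq by auto
  then obtain v where v: "nbrs T r = {v}" using leaves_iff by (auto simp: card_1_singleton_iff)
  then have rv: "{r, v} \<in> T" unfolding nbrs_def by auto
  have rnot: "r \<notin> branch T r v" using bridge[OF rv] .
  \<comment> \<open>Cutting the pendant edge at \<open>r\<close> leaves \<open>r\<close> alone and the binary tree with apex \<open>v\<close>.\<close>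
  have "branch T v r \<subseteq> {r}" using branch_cover[of v r "{}"] rv v by (auto simp: insert_commute)
  then have V: "V = insert r (branch T r v)" using two_branches(1)[OF rv] branch_self[of r T v] by blast
  obtain t0 where t0: "apex t0 = v" "hangs T r t0" "distinct_tree t0"
    using ex_hanging_tree[OF deg3 rv] by blast
  have vt0: "verts t0 = branch T r v" using hangs_branch[OF t0(2)] t0(1) by simp
  have sub: "verts t0 \<subseteq> V" using V vt0 by blast
  have "set (leaf_list t0) = verts t0 \<inter> leaves V T"
    using hangs_leaves[OF t0(2,3) _ sub] rnot vt0 by simp
  also have "\<dots> = set q" using p(2,3) pq V vt0 rnot unfolding leaves_def by auto
  finally have ll: "set q = set (leaf_list t0)" by simp
  obtain t where t: "hangs T r t" "distinct_tree t" "apex t = apex t0" "verts t = verts t0" "leaf_list t = q"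
    using reorder[OF t0(2,3) _ _ ll, of "[]" "[]"] rv t0(1) vt0 rnot by auto
  have rt: "r \<notin> verts t" using t(4) vt0 rnot by simp
  have q2: "2 \<le> length q" using p(1) pq by simp
  have C: "C = cycle_edges (r # q)" using p(4) pq by simp
  have inner: "nbrs C x = {}" if "x \<in> verts t" "x \<notin> set (leaf_list t)" for x
  proof -
    have "x \<notin> set (r # q)" using that rt t(5) by auto
    moreover have "\<Union> C \<subseteq> set (r # q)"
      using Union_path_edges_subset[of "r # q @ [r]"] unfolding C cycle_edges_Cons by auto
    ultimately show ?thesis unfolding nbrs_def by blast
  qed
  have "cycle_windows C (r # leaf_list t @ [r])"
    using cycle_windows_cycle[of r q] p(2) pq q2 unfolding C t(5) by simp
  moreover have "\<exists>l w s. t = Node l w s" using t(5) q2 by (cases t) auto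
  ultimately have att: "attached (T \<union> C) t r r r"
    using t(1,2) rt inner by (intro hangs_attached) auto
  obtain q1 where q1: "q = leftmost t # q1 @ [rightmost t]"
  proof -
    obtain x q' where q': "q = x # q'" "q' \<noteq> []" using q2 by (cases q; cases "tl q") auto
    then obtain q1 y where "q' = q1 @ [y]" by (meson rev_exhaust)
    then show thesis using that[of q1] q' leaf_list_ends(2,3)[of t] t(5) by simp
  qed
  have nC: "nbrs C r = {leftmost t, rightmost t}"
  proof -
    have C': "C = insert {r, leftmost t} (insert {rightmost t, r} (path_edges q))"
      using path_edges_snoc[of q r] unfolding C cycle_edges_Cons q1 by (simp add: path_edges_Cons)
    have nin: "{r, w} \<notin> path_edges q" for w
      using Union_path_edges_subset[of q] p(2) pq by auto
    have "{r, w} \<in> C \<longleftrightarrow> w = leftmost t \<or> w = rightmost t" for w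
      unfolding C' using nin[of w] by (auto simp: doubleton_eq_iff)
    then show ?thesis unfolding nbrs_def by auto
  qed
  have "leftmost t \<noteq> rightmost t" using p(2) pq q1 by auto
  moreover have "apex t \<notin> set q"
  proof -
    obtain l w s where n: "t = Node l w s" using \<open>\<exists>l w s. t = Node l w s\<close> by blast
    have "set (leaf_list t) \<subseteq> verts t" for t :: "'a btree" by (induction t) auto
    then have "set q \<subseteq> verts l \<union> verts s" using t(5) n by fastforce
    then show ?thesis using t(2) n by auto
  qed
  moreover have "leftmost t \<in> set q" "rightmost t \<in> set q"
    unfolding q1 by simp_all
  ultimately have dist: "distinct [apex t, leftmost t, rightmost t]" by auto
  have "nbrs (T \<union> C) r = nbrs T r \<union> nbrs C r" unfolding nbrs_def by auto
  then have "nbrs (T \<union> C) r = {apex t, leftmost t, rightmost t}" using nC v t(3) t0(1) by auto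
  then show thesis using that[OF t(2) rt _ att _ dist] V vt0 t(4) by simp
qed

theorem theorem3:
  fixes V :: "'a set" and T C :: "'a set set"
    and pos :: "'a \<Rightarrow> complex" and \<gamma> :: "'a set \<Rightarrow> real \<Rightarrow> complex"
  assumes "halin_graph V T C pos \<gamma>"
    and "regular 3 V (T \<union> C)"
  shows "star_chromatic_index V (T \<union> C) \<le> 6"
proof -
  obtain r t where t: "distinct_tree t" "r \<notin> verts t" "V = insert r (verts t)"
      "attached (T \<union> C) t r r r" "nbrs (T \<union> C) r = {apex t, leftmost t, rightmost t}"
      "distinct [apex t, leftmost t, rightmost t]"
    using cubic_halin_closed_tree[OF assms] by blast
  have closes: "closes t" using t(6) closes_Node by (cases t) auto
  have "simple_graph V (T \<union> C)" using assms(1) by (simp add: halin_graph_def plane_graph_def)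
  then have graph: "e \<subseteq> insert r (verts t) \<and> card e = 2" if "e \<in> T \<union> C" for e
    using that unfolding simple_graph_def t(3) by simp
  show ?thesis unfolding t(3) by (rule colour_closed_tree[OF t(1,2) closes t(4-6) graph])
qed

end
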